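(* Let $(M,F)$ be a Finsler surface with nonflat geodesic spray $S$, and let $(H,S,V,\mathcal{C})$ be its Berwald frame. Let $\mathcal{F}:=H(\mathcal{I})+V(\mathcal{J})$. Then $$S(\mathcal{J})+V(\rho)+\mathcal{I}\,\rho=0,\qquad S(\mathcal{F})+\mathcal{I}\,V(\rho)+V^2(\rho)=0,$$ where $V^2(\rho):=V(V(\rho))$.
   Context: $M$ is a $2$-dimensional smooth manifold, $\mathcal{T}M$ its tangent bundle with the zero section removed, with induced coordinates $(x^i,y^i)$; $J=\frac{\partial}{\partial y^i}\otimes dx^i$ is the almost-tangent structure and $\mathcal{C}=y^i\frac{\partial}{\partial y^i}$ the Liouville vector field. $F:TM\to\mathbb{R}$ is a Finsler function: smooth and positive on $\mathcal{T}M$, zero exactly on the zero section, positively $1$-homogeneous in $y$, with $g_{ij}=\frac12\frac{\partial^2F^2}{\partial y^i\partial y^j}$ of maximal rank on $\mathcal{T}M$. $S=y^i\frac{\partial}{\partial x^i}-2G^i\frac{\partial}{\partial y^i}$ is its geodesic spray, and "horizontal" refers to the image of the projector $h=\frac12(Id+[J,S])$ (Frölicher–Nijenhuis bracket). With $G^i_j=\partial G^i/\partial y^j$, the Jacobi endomorphism is $\Phi=\big(2\frac{\partial G^i}{\partial x^j}-S(G^i_j)-G^i_kG^k_j\big)\frac{\partial}{\partial y^i}\otimes dx^j$; in dimension $2$ one has $\Phi=K(F^2J-F\,d_JF\otimes\mathcal{C})$, where $K\in C^\infty(\mathcal{T}M)$ is the flag curvature; the Ricci scalar is $\rho=KF^2$.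 $S$ is nonflat: $K$ vanishes nowhere on $\mathcal{T}M$. Berwald frame: $H$ is a horizontal vector field on $\mathcal{T}M$ with $[\mathcal{C},H]=H$, $d_JF(H)=0$, $V:=JH$, normalized so that $[S,H]=\rho V$, $[V,S]=H$, $[H,V]=S+\mathcal{I}H+\mathcal{J}V$ with $\mathcal{J}=S(\mathcal{I})$. Here $\mathcal{I}$ is the main (Cartan) scalar and $\mathcal{J}$ the Landsberg scalar. *)

theory Defs
  imports "HOL-Analysis.Analysis"
begin

section \<open>Smooth manifolds\<close>

text \<open>For an open set \<open>U\<close>, \<open>smooth_on U f\<close> says that all iterated directional derivatives
  of \<open>f\<close> exist and are differentiable on \<open>U\<close>.\<close>

primrec times_differentiable_on ::
    "nat \<Rightarrow> 'a::euclidean_space set \<Rightarrow> ('a \<Rightarrow> 'b::real_normed_vector) \<Rightarrow> bool" where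
  "times_differentiable_on 0 U f \<longleftrightarrow> continuous_on U f"
| "times_differentiable_on (Suc k) U f \<longleftrightarrow> (\<forall>x\<in>U. f differentiable (at x)) \<and>
     (\<forall>v. times_differentiable_on k U (\<lambda>x. frechet_derivative f (at x) v))"

definition smooth_on :: "'a::euclidean_space set \<Rightarrow> ('a \<Rightarrow> 'b::real_normed_vector) \<Rightarrow> bool" where
  "smooth_on U f \<longleftrightarrow> (\<forall>k. times_differentiable_on k U f)"

text \<open>A chart is a pair of its domain and its coordinate map; values of the coordinate map outside
  the domain are irrelevant.\<close>

type_synonym ('p, 'e) chart = "'p set \<times> ('p \<Rightarrow> 'e)"

definition chart_image :: "('p, 'e) chart \<Rightarrow> 'e set" where
  "chart_image c = snd c ` fst c"

definition chart_inv :: "('p, 'e) chart \<Rightarrow> 'e \<Rightarrow> 'p" where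
  "chart_inv c = inv_into (fst c) (snd c)"

definition transition :: "('p, 'e) chart \<Rightarrow> ('p, 'e) chart \<Rightarrow> 'e \<Rightarrow> 'e" where
  "transition c d = snd d \<circ> chart_inv c"

definition carrier_of :: "('p, 'e) chart set \<Rightarrow> 'p set" where
  "carrier_of A = \<Union>(fst ` A)"

text \<open>The atlas need not be maximal.\<close>

definition smooth_manifold :: "'p topology \<Rightarrow> ('p, 'e::euclidean_space) chart set \<Rightarrow> bool" where
  "smooth_manifold X A \<longleftrightarrow>
     Hausdorff_space X \<and> second_countable X \<and> topspace X = carrier_of A \<and>
     (\<forall>c\<in>A. openin X (fst c) \<and> open (chart_image c) \<and>
        homeomorphic_map (subtopology X (fst c)) (top_of_set (chart_image c)) (snd c)) \<and>
     (\<forall>c\<in>A. \<forall>d\<in>A. smooth_on (snd c ` (fst c \<inter> fst d)) (transition c d))"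

definition smooth_function ::
    "('p, 'e::euclidean_space) chart set \<Rightarrow> ('p \<Rightarrow> real) \<Rightarrow> bool" where
  "smooth_function A f \<longleftrightarrow> (\<forall>c\<in>A. smooth_on (chart_image c) (f \<circ> chart_inv c))"

text \<open>A tangent vector at \<open>p\<close> is the family of its component vectors in all charts around \<open>p\<close>,
  related by the Jacobians of the transition maps. Families are extended by 0 to the remaining
  charts, so that equal tangent vectors are equal as functions.\<close>

type_synonym ('p, 'e) tangent = "('p, 'e) chart \<Rightarrow> 'e"

definition tangent_space ::
    "('p, 'e::euclidean_space) chart set \<Rightarrow> 'p \<Rightarrow> ('p, 'e) tangent set" where
  "tangent_space A p = {w.
     (\<forall>c. c \<notin> A \<or> p \<notin> fst c \<longrightarrow> w c = 0) \<and>
     (\<forall>c\<in>A. \<forall>d\<in>A. p \<in> fst c \<and> p \<in> fst d \<longrightarrow>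
        w d = frechet_derivative (transition c d) (at (snd c p)) (w c))}"

type_synonym ('p, 'e) vector_field = "'p \<Rightarrow> ('p, 'e) tangent"

definition local_field ::
    "('p, 'e) chart \<Rightarrow> ('p, 'e) vector_field \<Rightarrow> 'e \<Rightarrow> 'e" where
  "local_field c X u = X (chart_inv c u) c"

definition smooth_vector_field ::
    "('p, 'e::euclidean_space) chart set \<Rightarrow> ('p, 'e) vector_field \<Rightarrow> bool" where
  "smooth_vector_field A X \<longleftrightarrow>
     (\<forall>p\<in>carrier_of A. X p \<in> tangent_space A p) \<and>
     (\<forall>c\<in>A. smooth_on (chart_image c) (local_field c X))"

text \<open>The derivative of \<open>f\<close> at \<open>p\<close> along \<open>w\<close>, computed in some chart around \<open>p\<close>; for
  differentiable \<open>f\<close> and \<open>w \<in> tangent_space A p\<close> the chart does not matter.\<close>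

definition derivative_along ::
    "('p, 'e::euclidean_space) chart set \<Rightarrow> 'p \<Rightarrow> ('p, 'e) tangent \<Rightarrow> ('p \<Rightarrow> real) \<Rightarrow> real" where
  "derivative_along A p w f =
     (let c = (SOME c. c \<in> A \<and> p \<in> fst c)
      in frechet_derivative (f \<circ> chart_inv c) (at (snd c p)) (w c))"

definition field_apply ::
    "('p, 'e::euclidean_space) chart set \<Rightarrow> ('p, 'e) vector_field \<Rightarrow> ('p \<Rightarrow> real) \<Rightarrow> ('p \<Rightarrow> real)"
  where "field_apply A X f = (\<lambda>p. derivative_along A p (X p) f)"

definition lie_bracket ::
    "('p, 'e::euclidean_space) chart set \<Rightarrow> ('p, 'e) vector_field \<Rightarrow> ('p, 'e) vector_field
      \<Rightarrow> ('p, 'e) vector_field" where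
  "lie_bracket A X Y p = (\<lambda>c. if c \<in> A \<and> p \<in> fst c
     then frechet_derivative (local_field c Y) (at (snd c p)) (X p c)
        - frechet_derivative (local_field c X) (at (snd c p)) (Y p c)
     else 0)"


section \<open>The tangent bundle of a surface and its induced coordinates\<close>

type_synonym 'm surface_chart = "('m, real^2) chart"
type_synonym 'm tm = "'m \<times> ('m, real^2) tangent"
type_synonym 'm tm_chart = "('m tm, (real^2) \<times> (real^2)) chart"
type_synonym 'm tm_tangent = "('m tm, (real^2) \<times> (real^2)) tangent"
type_synonym 'm tm_field = "('m tm, (real^2) \<times> (real^2)) vector_field"

definition slit_bundle :: "'m surface_chart set \<Rightarrow> 'm tm set" where
  "slit_bundle A = {(p, w). p \<in> carrier_of A \<and> w \<in> tangent_space A p \<and> w \<noteq> (\<lambda>_. 0)}"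

definition induced_chart :: "'m surface_chart set \<Rightarrow> 'm surface_chart \<Rightarrow> 'm tm_chart" where
  "induced_chart A c = ({q \<in> slit_bundle A. fst q \<in> fst c}, \<lambda>(p, w). (snd c p, w c))"

definition slit_atlas :: "'m surface_chart set \<Rightarrow> 'm tm_chart set" where
  "slit_atlas A = induced_chart A ` A"

text \<open>\<open>\<partial>f/\<partial>x\<^sup>i\<close> and \<open>\<partial>f/\<partial>y\<^sup>i\<close> for functions of the induced coordinates \<open>u = (x, y)\<close>.\<close>

definition partial_x :: "2 \<Rightarrow> ((real^2) \<times> (real^2) \<Rightarrow> real) \<Rightarrow> (real^2) \<times> (real^2) \<Rightarrow> real" where
  "partial_x i f u = frechet_derivative f (at u) (axis i 1, 0)"

definition partial_y :: "2 \<Rightarrow> ((real^2) \<times> (real^2) \<Rightarrow> real) \<Rightarrow> (real^2) \<times> (real^2) \<Rightarrow> real" where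
  "partial_y i f u = frechet_derivative f (at u) (0, axis i 1)"

text \<open>The almost-tangent structure \<open>J = \<partial>/\<partial>y\<^sup>i \<otimes> dx\<^sup>i\<close>, on tangent vectors and on fields.\<close>

definition tangent_structure :: "'m tm_tangent \<Rightarrow> 'm tm_tangent" where
  "tangent_structure \<xi> = (\<lambda>c. (0, fst (\<xi> c)))"

definition tangent_structure_field :: "'m tm_field \<Rightarrow> 'm tm_field" where
  "tangent_structure_field X = (\<lambda>q. tangent_structure (X q))"

definition liouville_field :: "'m surface_chart set \<Rightarrow> 'm tm_field" where
  "liouville_field A q = (\<lambda>c. if c \<in> slit_atlas A \<and> q \<in> fst c then (0, snd (snd c q)) else 0)"


section \<open>Finsler functions and their geodesic sprays\<close>

definition local_energy :: "'m tm_chart \<Rightarrow> ('m tm \<Rightarrow> real) \<Rightarrow> (real^2) \<times> (real^2) \<Rightarrow> real" where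
  "local_energy c F u = (F (chart_inv c u))\<^sup>2"

definition fundamental_matrix ::
    "'m tm_chart \<Rightarrow> ('m tm \<Rightarrow> real) \<Rightarrow> (real^2) \<times> (real^2) \<Rightarrow> real^2^2" where
  "fundamental_matrix c F u =
     (\<chi> i j. (1/2) * partial_y i (partial_y j (local_energy c F)) u)"

definition finsler_function :: "'m surface_chart set \<Rightarrow> ('m tm \<Rightarrow> real) \<Rightarrow> bool" where
  "finsler_function A F \<longleftrightarrow>
     smooth_function (slit_atlas A) F \<and>
     (\<forall>q\<in>slit_bundle A. F q > 0) \<and>
     (\<forall>p\<in>carrier_of A. F (p, \<lambda>_. 0) = 0) \<and>
     (\<forall>p\<in>carrier_of A. \<forall>w\<in>tangent_space A p. \<forall>t>0. F (p, \<lambda>c. t *\<^sub>R w c) = t * F (p, w)) \<and>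
     (\<forall>c\<in>slit_atlas A. \<forall>u\<in>chart_image c. rank (fundamental_matrix c F u) = 2)"

text \<open>The geodesic spray is the second-order field \<open>S = y\<^sup>i \<partial>/\<partial>x\<^sup>i - 2 G\<^sup>i \<partial>/\<partial>y\<^sup>i\<close> solving the
  Euler-Lagrange equations \<open>S (\<partial>F\<^sup>2/\<partial>y\<^sup>i) = \<partial>F\<^sup>2/\<partial>x\<^sup>i\<close>; they determine \<open>S\<close>, the fundamental
  matrix being invertible.\<close>

definition geodesic_spray :: "'m surface_chart set \<Rightarrow> ('m tm \<Rightarrow> real) \<Rightarrow> 'm tm_field \<Rightarrow> bool" where
  "geodesic_spray A F S \<longleftrightarrow>
     smooth_vector_field (slit_atlas A) S \<and>
     (\<forall>c\<in>slit_atlas A. \<forall>u\<in>chart_image c.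
        fst (local_field c S u) = snd u \<and>
        (\<forall>i. frechet_derivative (partial_y i (local_energy c F)) (at u) (local_field c S u)
             = partial_x i (local_energy c F) u))"

definition spray_coeff :: "'m tm_chart \<Rightarrow> 'm tm_field \<Rightarrow> 2 \<Rightarrow> (real^2) \<times> (real^2) \<Rightarrow> real" where
  "spray_coeff c S i u = - (1/2) * (snd (local_field c S u) $ i)"

definition connection_coeff ::
    "'m tm_chart \<Rightarrow> 'm tm_field \<Rightarrow> 2 \<Rightarrow> 2 \<Rightarrow> (real^2) \<times> (real^2) \<Rightarrow> real" where
  "connection_coeff c S i j = partial_y j (spray_coeff c S i)"

text \<open>The horizontal projector \<open>h = (Id + [J,S])/2\<close>, with the Froelicher-Nijenhuis bracket
  \<open>[J,S] X = [JX,S] - J [X,S]\<close>.\<close>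

definition horizontal_projector ::
    "'m surface_chart set \<Rightarrow> 'm tm_field \<Rightarrow> 'm tm_field \<Rightarrow> 'm tm_field" where
  "horizontal_projector A S X q = (\<lambda>c. (1/2) *\<^sub>R
     (X q c + (lie_bracket (slit_atlas A) (tangent_structure_field X) S q c
               - tangent_structure (lie_bracket (slit_atlas A) X S q) c)))"

definition horizontal :: "'m surface_chart set \<Rightarrow> 'm tm_field \<Rightarrow> 'm tm_field \<Rightarrow> bool" where
  "horizontal A S H \<longleftrightarrow> (\<exists>X. smooth_vector_field (slit_atlas A) X \<and>
     (\<forall>q\<in>slit_bundle A. H q = horizontal_projector A S X q))"


section \<open>Curvature\<close>

definition jacobi_coeff ::
    "'m tm_chart \<Rightarrow> 'm tm_field \<Rightarrow> 2 \<Rightarrow> 2 \<Rightarrow> (real^2) \<times> (real^2) \<Rightarrow> real" where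
  "jacobi_coeff c S i j u =
     2 * partial_x j (spray_coeff c S i) u
     - frechet_derivative (connection_coeff c S i j) (at u) (local_field c S u)
     - (\<Sum>k\<in>UNIV. connection_coeff c S i k u * connection_coeff c S k j u)"

definition jacobi_endomorphism ::
    "'m surface_chart set \<Rightarrow> 'm tm_field \<Rightarrow> 'm tm \<Rightarrow> 'm tm_tangent \<Rightarrow> 'm tm_tangent" where
  "jacobi_endomorphism A S q \<xi> = (\<lambda>c. if c \<in> slit_atlas A \<and> q \<in> fst c
     then (0, \<chi> i. \<Sum>j\<in>UNIV. jacobi_coeff c S i j (snd c q) * (fst (\<xi> c) $ j))
     else 0)"

text \<open>The one-form \<open>d\<^sub>Jf = df \<circ> J\<close>.\<close>

definition d_J :: "'m surface_chart set \<Rightarrow> ('m tm \<Rightarrow> real) \<Rightarrow> 'm tm \<Rightarrow> 'm tm_tangent \<Rightarrow> real" where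
  "d_J A f q \<xi> = derivative_along (slit_atlas A) q (tangent_structure \<xi>) f"

text \<open>\<open>K\<close> is the flag curvature: \<open>\<Phi> = K (F\<^sup>2 J - F d\<^sub>JF \<otimes> \<C>)\<close>.\<close>

definition flag_curvature ::
    "'m surface_chart set \<Rightarrow> ('m tm \<Rightarrow> real) \<Rightarrow> 'm tm_field \<Rightarrow> ('m tm \<Rightarrow> real) \<Rightarrow> bool" where
  "flag_curvature A F S K \<longleftrightarrow>
     smooth_function (slit_atlas A) K \<and>
     (\<forall>q\<in>slit_bundle A. \<forall>\<xi>\<in>tangent_space (slit_atlas A) q.
        jacobi_endomorphism A S q \<xi> = (\<lambda>c. K q *\<^sub>R
          ((F q)\<^sup>2 *\<^sub>R tangent_structure \<xi> c - (F q * d_J A F q \<xi>) *\<^sub>R liouville_field A q c)))"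

definition nonflat :: "'m surface_chart set \<Rightarrow> ('m tm \<Rightarrow> real) \<Rightarrow> bool" where
  "nonflat A K \<longleftrightarrow> (\<forall>q\<in>slit_bundle A. K q \<noteq> 0)"

definition ricci_scalar :: "('m tm \<Rightarrow> real) \<Rightarrow> ('m tm \<Rightarrow> real) \<Rightarrow> 'm tm \<Rightarrow> real" where
  "ricci_scalar F K q = K q * (F q)\<^sup>2"


section \<open>The Berwald frame\<close>

definition landsberg_scalar ::
    "'m surface_chart set \<Rightarrow> 'm tm_field \<Rightarrow> ('m tm \<Rightarrow> real) \<Rightarrow> 'm tm \<Rightarrow> real" where
  "landsberg_scalar A S \<I> = field_apply (slit_atlas A) S \<I>"

text \<open>\<open>H\<close> completes \<open>S\<close> and \<open>\<C>\<close> to the Berwald frame \<open>(H, S, V, \<C>)\<close>, \<open>V = JH\<close>; \<open>\<I>\<close> is the main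
  scalar, which the bracket relation for \<open>[H,V]\<close> defines.\<close>

definition berwald_frame ::
    "'m surface_chart set \<Rightarrow> ('m tm \<Rightarrow> real) \<Rightarrow> 'm tm_field \<Rightarrow> ('m tm \<Rightarrow> real)
      \<Rightarrow> 'm tm_field \<Rightarrow> ('m tm \<Rightarrow> real) \<Rightarrow> bool" where
  "berwald_frame A F S K H \<I> \<longleftrightarrow>
     (let B = slit_atlas A; V = tangent_structure_field H; \<J> = landsberg_scalar A S \<I> in
      smooth_vector_field B H \<and> smooth_function B \<I> \<and> horizontal A S H \<and>
      (\<forall>q\<in>slit_bundle A.
         lie_bracket B (liouville_field A) H q = H q \<and>
         d_J A F q (H q) = 0 \<and>
         lie_bracket B S H q = (\<lambda>c. ricci_scalar F K q *\<^sub>R V q c) \<and>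
         lie_bracket B V S q = H q \<and>
         lie_bracket B H V q = (\<lambda>c. S q c + \<I> q *\<^sub>R H q c + \<J> q *\<^sub>R V q c)))"

end

theory Submission
  imports Defs
begin

text \<open>
  Both identities follow from the structure equations \<open>[S,H] = \<rho>V\<close>, \<open>[V,S] = H\<close>,
  \<open>[H,V] = S + \<I>H + \<J>V\<close> with \<open>\<J> = S(\<I>)\<close>. The first one is the Jacobi identity
  \<open>[S,[H,V]] + [H,[V,S]] + [V,[S,H]] = 0\<close>: the middle term is \<open>[H,H] = 0\<close>, the last one is
  \<open>V(\<rho>)V\<close>, and the first one is \<open>(\<I>\<rho> + S(\<J>))V\<close> because its \<open>H\<close>-components \<open>S(\<I>)\<close> and \<open>-\<J>\<close>
  cancel. Since \<open>V\<close> has no zeros, its coefficient vanishes. For the second identity, commute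
  \<open>S\<close> past \<open>H\<close> and \<open>V\<close> in \<open>S(\<F>) = S(H(\<I>)) + S(V(\<J>))\<close>:
  this gives \<open>\<rho>V(\<I>) + V(S(\<J>))\<close>, and the first identity differentiated along \<open>V\<close> evaluates
  \<open>V(S(\<J>))\<close>.

  This computation takes place in a single chart, in lemma
  \<open>bianchi_identities_of_structure_equations\<close>. It rests on
  \<open>[X,Y] f = X(Y f) - Y(X f)\<close> (\<open>directional_derivative_commutator\<close>), that is, on the symmetry of
  second derivatives. There the Jacobi identity appears in operator form: apply \<open>S\<close> to \<open>H(V f) - V(H f) = S f + \<I> H(f) + \<J> V(f)\<close> for an arbitrary function \<open>f\<close>.

  Three geometric facts connect the chart computation with the slit tangent bundle.
  Iterated derivatives such as \<open>V(V(\<rho>))\<close> are computed pointwise in varying charts, so the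
  derivative along a tangent vector has to be independent of the chart; for this, the induced charts
  must form an atlas with differentiable transition maps
  \<open>(x, y) \<mapsto> (\<tau>(x), D\<tau>(x) y)\<close> (\<open>differentiable_atlas_slit_atlas\<close>). By the triangular form of their
  derivatives, \<open>V = JH\<close> is again a vector field
  (\<open>smooth_vector_field_tangent_structure_field\<close>). Finally \<open>V\<close> has no zeros
  (\<open>berwald_vertical_field_nonzero\<close>): at a zero of \<open>V\<close> the horizontal field \<open>H\<close> would vanish as
  well, hence so would \<open>[H,V]\<close> and, by the third structure equation, \<open>S\<close>; but the
  \<open>\<partial>/\<partial>x\<close>-component of \<open>S\<close> is \<open>y \<noteq> 0\<close>.
\<close>

section \<open>Smooth maps between Euclidean spaces\<close>

lemma frechet_derivative_eqI:
  "(f has_derivative f') (at x) \<Longrightarrow> frechet_derivative f (at x) = f'"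
  by (simp add: frechet_derivative_at[symmetric])

text \<open>A Frechet derivative at a point of an open set sees only the values on that set. Closure under
  sums, products and bounded linear maps uses this to replace the derivative of a compound map by its formula,
  which holds only on \<open>U\<close>.\<close>

lemma times_differentiable_on_cong:
  assumes "open U" and "\<And>x. x \<in> U \<Longrightarrow> f x = g x"
  shows "times_differentiable_on k U f \<longleftrightarrow> times_differentiable_on k U g"
  using assms(2)
proof (induction k arbitrary: f g)
  case 0
  then show ?case by (auto cong: continuous_on_cong)
next
  case (Suc k)
  have diff: "f differentiable (at x) \<longleftrightarrow> g differentiable (at x)" if "x \<in> U" for x
    using has_derivative_transform_within_open[of f _ x UNIV U g]
      has_derivative_transform_within_open[of g _ x UNIV U f] assms(1) that Suc.prems
    unfolding differentiable_def by metis
  show ?case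
  proof (cases "\<forall>x\<in>U. f differentiable (at x)")
    case True
    have "frechet_derivative f (at x) v = frechet_derivative g (at x) v" if "x \<in> U" for x v
      using frechet_derivative_transform_within_open[of f x U g] True Suc.prems assms(1) that by auto
    then show ?thesis
      using Suc.IH[of "\<lambda>x. frechet_derivative f (at x) v" "\<lambda>x. frechet_derivative g (at x) v" for v]
        diff by auto
  next
    case False
    then show ?thesis using diff by auto
  qed
qed

lemma smooth_on_cong:
  assumes "open U" and "\<And>x. x \<in> U \<Longrightarrow> f x = g x"
  shows "smooth_on U f \<longleftrightarrow> smooth_on U g"
  unfolding smooth_on_def using times_differentiable_on_cong[OF assms] by simp

lemma times_differentiable_on_pred:
  "times_differentiable_on (Suc k) U f \<Longrightarrow> times_differentiable_on k U f"
proof (induction k arbitrary: f)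
  case 0
  then show ?case
    by (auto intro!: continuous_at_imp_continuous_on differentiable_imp_continuous_within)
next
  case (Suc k)
  then show ?case by (metis times_differentiable_on.simps(2))
qed

lemma smooth_on_differentiable: "smooth_on U f \<Longrightarrow> x \<in> U \<Longrightarrow> f differentiable (at x)"
  unfolding smooth_on_def by (metis times_differentiable_on.simps(2))

lemma smooth_on_continuous: "smooth_on U f \<Longrightarrow> continuous_on U f"
  unfolding smooth_on_def by (metis times_differentiable_on.simps(1))

lemma smooth_on_frechet_derivative:
  "smooth_on U f \<Longrightarrow> smooth_on U (\<lambda>x. frechet_derivative f (at x) v)"
  unfolding smooth_on_def by (metis times_differentiable_on.simps(2))

lemma times_differentiable_on_const: "times_differentiable_on k U (\<lambda>x. c)"
  by (induction k arbitrary: c) auto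

lemma times_differentiable_on_add:
  assumes "open U"
  shows "times_differentiable_on k U f \<Longrightarrow> times_differentiable_on k U g \<Longrightarrow>
    times_differentiable_on k U (\<lambda>x. f x + g x)"
proof (induction k arbitrary: f g)
  case 0
  then show ?case by (simp add: continuous_on_add)
next
  case (Suc k)
  have "times_differentiable_on k U (\<lambda>x. frechet_derivative (\<lambda>x. f x + g x) (at x) v) \<longleftrightarrow>
    times_differentiable_on k U (\<lambda>x. frechet_derivative f (at x) v + frechet_derivative g (at x) v)" for v
  proof (rule times_differentiable_on_cong[OF assms])
    fix x assume "x \<in> U"
    then have "((\<lambda>x. f x + g x) has_derivative
      (\<lambda>v. frechet_derivative f (at x) v + frechet_derivative g (at x) v)) (at x)"
      using Suc.prems by (intro has_derivative_add) (auto simp: frechet_derivative_works[symmetric])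
    then show "frechet_derivative (\<lambda>x. f x + g x) (at x) v =
      frechet_derivative f (at x) v + frechet_derivative g (at x) v"
      by (simp add: frechet_derivative_eqI)
  qed
  then show ?case using Suc by auto
qed

text \<open>The Leibniz rule writes the derivative of \<open>f g\<close> as a sum of products of maps that are \<open>k\<close>
  times differentiable, so that the induction hypothesis applies to it.\<close>

lemma times_differentiable_on_mult:
  fixes f g :: "'a::euclidean_space \<Rightarrow> real"
  assumes "open U"
  shows "times_differentiable_on k U f \<Longrightarrow> times_differentiable_on k U g \<Longrightarrow>
    times_differentiable_on k U (\<lambda>x. f x * g x)"
proof (induction k arbitrary: f g)
  case 0
  then show ?case by (simp add: continuous_on_mult)
next
  case (Suc k)
  have "times_differentiable_on k U (\<lambda>x. frechet_derivative (\<lambda>x. f x * g x) (at x) v) \<longleftrightarrow>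
    times_differentiable_on k U
      (\<lambda>x. f x * frechet_derivative g (at x) v + frechet_derivative f (at x) v * g x)" for v
  proof (rule times_differentiable_on_cong[OF assms])
    fix x assume "x \<in> U"
    then have "((\<lambda>x. f x * g x) has_derivative
      (\<lambda>v. f x * frechet_derivative g (at x) v + frechet_derivative f (at x) v * g x)) (at x)"
      using Suc.prems by (intro has_derivative_mult) (auto simp: frechet_derivative_works[symmetric])
    then show "frechet_derivative (\<lambda>x. f x * g x) (at x) v =
      f x * frechet_derivative g (at x) v + frechet_derivative f (at x) v * g x"
      by (simp add: frechet_derivative_eqI)
  qed
  moreover have "times_differentiable_on k U
      (\<lambda>x. f x * frechet_derivative g (at x) v + frechet_derivative f (at x) v * g x)" for v
    using Suc.prems
    by (intro times_differentiable_on_add[OF assms] Suc.IH)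
      (auto intro: times_differentiable_on_pred[of k U f] times_differentiable_on_pred[of k U g])
  ultimately show ?case using Suc.prems by auto
qed

lemma times_differentiable_on_bounded_linear:
  assumes "open U" and h: "bounded_linear h"
  shows "times_differentiable_on k U f \<Longrightarrow> times_differentiable_on k U (\<lambda>x. h (f x))"
proof (induction k arbitrary: f)
  case 0
  then show ?case using bounded_linear.continuous_on[OF h] by simp
next
  case (Suc k)
  have deriv: "((\<lambda>x. h (f x)) has_derivative (\<lambda>v. h (frechet_derivative f (at x) v))) (at x)"
    if "x \<in> U" for x
    using Suc.prems that
    by (intro bounded_linear.has_derivative[OF h]) (auto simp: frechet_derivative_works[symmetric])
  have "times_differentiable_on k U (\<lambda>x. frechet_derivative (\<lambda>x. h (f x)) (at x) v) \<longleftrightarrow>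
    times_differentiable_on k U (\<lambda>x. h (frechet_derivative f (at x) v))" for v
    by (rule times_differentiable_on_cong[OF assms(1)]) (metis deriv frechet_derivative_at)
  then show ?case using Suc deriv by (auto intro: differentiableI)
qed

lemma smooth_on_const: "smooth_on U (\<lambda>x. c)"
  by (simp add: smooth_on_def times_differentiable_on_const)

lemma smooth_on_add:
  "open U \<Longrightarrow> smooth_on U f \<Longrightarrow> smooth_on U g \<Longrightarrow> smooth_on U (\<lambda>x. f x + g x)"
  by (simp add: smooth_on_def times_differentiable_on_add)

lemma smooth_on_mult:
  fixes f g :: "'a::euclidean_space \<Rightarrow> real"
  shows "open U \<Longrightarrow> smooth_on U f \<Longrightarrow> smooth_on U g \<Longrightarrow> smooth_on U (\<lambda>x. f x * g x)"
  by (simp add: smooth_on_def times_differentiable_on_mult)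

lemma smooth_on_bounded_linear:
  "open U \<Longrightarrow> bounded_linear h \<Longrightarrow> smooth_on U f \<Longrightarrow> smooth_on U (\<lambda>x. h (f x))"
  by (simp add: smooth_on_def times_differentiable_on_bounded_linear)

lemma smooth_on_sum:
  "open U \<Longrightarrow> (\<And>i. i \<in> I \<Longrightarrow> smooth_on U (f i)) \<Longrightarrow> smooth_on U (\<lambda>x. \<Sum>i\<in>I. f i x)"
  by (induction I rule: infinite_finite_induct) (auto intro: smooth_on_const smooth_on_add)

lemma smooth_on_bounded_linear_self:
  assumes "open U" "bounded_linear h"
  shows "smooth_on U h"
proof -
  have "times_differentiable_on k U h" for k
  proof (cases k)
    case 0
    then show ?thesis using assms linear_continuous_on by auto
  next
    case (Suc j)
    have "(h has_derivative h) (at x)" for x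
      using assms by (simp add: bounded_linear_imp_has_derivative)
    then have "frechet_derivative h (at x) = h" "h differentiable at x" for x
      by (auto simp: frechet_derivative_eqI intro: differentiableI)
    then show ?thesis by (simp add: Suc times_differentiable_on_const)
  qed
  then show ?thesis by (simp add: smooth_on_def)
qed

lemma frechet_derivative_sum_Basis:
  assumes "f differentiable (at x)"
  shows "frechet_derivative f (at x) v = (\<Sum>b\<in>Basis. (v \<bullet> b) *\<^sub>R frechet_derivative f (at x) b)"
proof -
  interpret linear "frechet_derivative f (at x)"
    by (rule linear_frechet_derivative[OF assms])
  have "frechet_derivative f (at x) (\<Sum>b\<in>Basis. (v \<bullet> b) *\<^sub>R b) =
    (\<Sum>b\<in>Basis. (v \<bullet> b) *\<^sub>R frechet_derivative f (at x) b)"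
    by (simp add: sum scale)
  then show ?thesis by (simp add: euclidean_representation)
qed

text \<open>The second difference of \<open>f\<close> over a parallelogram is symmetric in its two sides. Applying the
  mean value theorem first along \<open>a\<close> to the difference in direction \<open>b\<close>, and then along \<open>b\<close>,
  evaluates it as a mixed second derivative at some point of the parallelogram.\<close>

lemma second_difference_mean_value:
  fixes f :: "'a::euclidean_space \<Rightarrow> real"
  assumes "smooth_on U f" and "t > 0"
    and U: "\<And>s r. s \<in> {0..t} \<Longrightarrow> r \<in> {0..t} \<Longrightarrow> x + s *\<^sub>R a + r *\<^sub>R b \<in> U"
  shows "\<exists>s\<in>{0..t}. \<exists>r\<in>{0..t}.
    f (x + t *\<^sub>R a + t *\<^sub>R b) - f (x + t *\<^sub>R a) - f (x + t *\<^sub>R b) + f x =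
    t * (t * frechet_derivative (\<lambda>u. frechet_derivative f (at u) a) (at (x + s *\<^sub>R a + r *\<^sub>R b)) b)"
proof -
  have along: "((\<lambda>s. g (p + s *\<^sub>R v)) has_real_derivative frechet_derivative g (at (p + s *\<^sub>R v)) v) (at s)"
    if "g differentiable (at (p + s *\<^sub>R v))" for g :: "'a \<Rightarrow> real" and p v s
  proof -
    have "((\<lambda>s. g (p + s *\<^sub>R v)) has_derivative
        (\<lambda>h. frechet_derivative g (at (p + s *\<^sub>R v)) (h *\<^sub>R v))) (at s)"
      by (rule has_derivative_compose[of "\<lambda>s. p + s *\<^sub>R v", OF _ that[unfolded frechet_derivative_works]])
        (auto intro!: derivative_eq_intros)
    moreover have "frechet_derivative g (at (p + s *\<^sub>R v)) (h *\<^sub>R v) =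
        h * frechet_derivative g (at (p + s *\<^sub>R v)) v" for h
      using linear_cmul[OF linear_frechet_derivative[OF that]] by simp
    ultimately show ?thesis
      by (simp add: has_field_derivative_def mult.commute[of _ "frechet_derivative g (at (p + s *\<^sub>R v)) v"])
  qed
  have diff: "f differentiable (at u)" "(\<lambda>u. frechet_derivative f (at u) a) differentiable (at u)"
    if "u \<in> U" for u
    using assms(1) that smooth_on_differentiable smooth_on_frechet_derivative by blast+
  define \<phi> where "\<phi> s = f ((x + t *\<^sub>R b) + s *\<^sub>R a) - f (x + s *\<^sub>R a)" for s
  define \<phi>' where "\<phi>' s = frechet_derivative f (at ((x + t *\<^sub>R b) + s *\<^sub>R a)) a
      - frechet_derivative f (at (x + s *\<^sub>R a)) a" for s
  have "(\<phi> has_real_derivative \<phi>' s) (at s)" if "0 \<le> s" "s \<le> t" for s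
  proof -
    have "(x + t *\<^sub>R b) + s *\<^sub>R a \<in> U" "x + s *\<^sub>R a \<in> U"
      using U[of s t] U[of s 0] that \<open>t > 0\<close> by (simp_all add: algebra_simps)
    then show ?thesis
      unfolding \<phi>_def \<phi>'_def by (intro DERIV_diff along diff)
  qed
  then obtain s where s: "0 < s" "s < t" "\<phi> t - \<phi> 0 = (t - 0) * \<phi>' s"
    using MVT2[OF \<open>t > 0\<close>, of \<phi> \<phi>'] by blast
  have "((\<lambda>r. frechet_derivative f (at (x + s *\<^sub>R a + r *\<^sub>R b)) a) has_real_derivative
      frechet_derivative (\<lambda>u. frechet_derivative f (at u) a) (at (x + s *\<^sub>R a + r *\<^sub>R b)) b) (at r)"
    if "0 \<le> r" "r \<le> t" for r
    using U[of s r] s that by (intro along[of "\<lambda>u. frechet_derivative f (at u) a"] diff) auto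
  from MVT2[OF \<open>t > 0\<close> this] obtain r where r: "0 < r" "r < t"
    "frechet_derivative f (at (x + s *\<^sub>R a + t *\<^sub>R b)) a - frechet_derivative f (at (x + s *\<^sub>R a + 0 *\<^sub>R b)) a =
     (t - 0) * frechet_derivative (\<lambda>u. frechet_derivative f (at u) a) (at (x + s *\<^sub>R a + r *\<^sub>R b)) b"
    by blast
  have "\<phi>' s = t * frechet_derivative (\<lambda>u. frechet_derivative f (at u) a) (at (x + s *\<^sub>R a + r *\<^sub>R b)) b"
    using r(3) by (simp add: \<phi>'_def add_ac)
  moreover have "f (x + t *\<^sub>R a + t *\<^sub>R b) - f (x + t *\<^sub>R a) - f (x + t *\<^sub>R b) + f x = \<phi> t - \<phi> 0"
    by (simp add: \<phi>_def add_ac)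
  ultimately have "f (x + t *\<^sub>R a + t *\<^sub>R b) - f (x + t *\<^sub>R a) - f (x + t *\<^sub>R b) + f x =
    t * (t * frechet_derivative (\<lambda>u. frechet_derivative f (at u) a) (at (x + s *\<^sub>R a + r *\<^sub>R b)) b)"
    using s(3) by simp
  then show ?thesis using s r by (meson atLeastAtMost_iff less_imp_le)
qed

text \<open>The two orders of differentiation evaluate the same second difference, at two points of a
  parallelogram that may be chosen arbitrarily small; continuity of the second derivatives then
  forces them to agree at the corner \<open>x\<close>.\<close>

lemma second_derivative_symmetric:
  fixes f :: "'a::euclidean_space \<Rightarrow> real"
  assumes "open U" and f: "smooth_on U f" and x: "x \<in> U"
  shows "frechet_derivative (\<lambda>u. frechet_derivative f (at u) a) (at x) b =
         frechet_derivative (\<lambda>u. frechet_derivative f (at u) b) (at x) a"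
proof (rule ccontr)
  define p where "p a b u = frechet_derivative (\<lambda>u. frechet_derivative f (at u) a) (at u) b" for a b u
  assume "\<not> ?thesis"
  then have neq: "\<bar>p a b x - p b a x\<bar> > 0" (is "?e > 0") by (simp add: p_def)
  have "continuous_on U (p a b)" for a b
    unfolding p_def by (intro smooth_on_continuous smooth_on_frechet_derivative f)
  then have "isCont (p a b) x" for a b
    using assms(1) x continuous_on_eq_continuous_at by blast
  then have "\<forall>\<^sub>F u in nhds x. dist (p a b u) (p a b x) < ?e / 2" for a b
    using neq tendstoD[of "p a b" "p a b x" "nhds x" "?e / 2" for a b]
    by (simp add: isCont_def tendsto_at_iff_tendsto_nhds)
  then have "\<forall>\<^sub>F u in nhds x. u \<in> U \<and> dist (p a b u) (p a b x) < ?e / 2 \<and> dist (p b a u) (p b a x) < ?e / 2"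
    using eventually_nhds_in_open[OF assms(1) x] by (intro eventually_conj) auto
  then obtain d where "d > 0" and d: "\<And>u. dist u x < d \<Longrightarrow>
     u \<in> U \<and> dist (p a b u) (p a b x) < ?e / 2 \<and> dist (p b a u) (p b a x) < ?e / 2"
    unfolding eventually_nhds_metric by blast
  \<comment> \<open>This makes the parallelogram with sides \<open>t a\<close> and \<open>t b\<close> fit in the ball of radius \<open>d\<close>.\<close>
  define t where "t = d / (2 * (norm a + norm b + 1))"
  have "norm a + norm b + 1 > 0" by (simp add: add_nonneg_pos)
  then have "t > 0" using \<open>d > 0\<close> by (simp add: t_def)
  have near: "dist (x + s *\<^sub>R a + r *\<^sub>R b) x < d" if "s \<in> {0..t}" "r \<in> {0..t}" for s r
  proof -
    have "dist (x + s *\<^sub>R a + r *\<^sub>R b) x \<le> s * norm a + r * norm b"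
      using that norm_triangle_ineq[of "s *\<^sub>R a" "r *\<^sub>R b"] by (simp add: dist_norm)
    also have "\<dots> \<le> t * norm a + t * norm b"
      using that by (intro add_mono mult_right_mono) auto
    also have "\<dots> \<le> t * (norm a + norm b + 1)" using \<open>t > 0\<close> by (simp add: algebra_simps)
    also have "\<dots> = d / 2"
      using \<open>norm a + norm b + 1 > 0\<close> by (simp add: t_def field_simps)
    finally show ?thesis using \<open>d > 0\<close> by simp
  qed
  let ?\<Delta> = "f (x + t *\<^sub>R a + t *\<^sub>R b) - f (x + t *\<^sub>R a) - f (x + t *\<^sub>R b) + f x"
  obtain s r where sr: "s \<in> {0..t}" "r \<in> {0..t}" "?\<Delta> = t * (t * p a b (x + s *\<^sub>R a + r *\<^sub>R b))"
    using second_difference_mean_value[OF f \<open>t > 0\<close>, of x a b] d near unfolding p_def by blast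
  have "x + s *\<^sub>R b + r *\<^sub>R a \<in> U" if "s \<in> {0..t}" "r \<in> {0..t}" for s r
    using d near[OF that(2,1)] by (simp add: add_ac)
  then obtain s' r' where sr': "s' \<in> {0..t}" "r' \<in> {0..t}"
    "f (x + t *\<^sub>R b + t *\<^sub>R a) - f (x + t *\<^sub>R b) - f (x + t *\<^sub>R a) + f x = t * (t * p b a (x + s' *\<^sub>R b + r' *\<^sub>R a))"
    using second_difference_mean_value[OF f \<open>t > 0\<close>, of x b a] unfolding p_def by blast
  have commute: "x + t *\<^sub>R b + t *\<^sub>R a = x + t *\<^sub>R a + t *\<^sub>R b"
    "x + s' *\<^sub>R b + r' *\<^sub>R a = x + r' *\<^sub>R a + s' *\<^sub>R b"
    by simp_all
  have "t * (t * p a b (x + s *\<^sub>R a + r *\<^sub>R b)) = t * (t * p b a (x + r' *\<^sub>R a + s' *\<^sub>R b))"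
    using sr(3) sr'(3) unfolding commute by linarith
  then have "p a b (x + s *\<^sub>R a + r *\<^sub>R b) = p b a (x + r' *\<^sub>R a + s' *\<^sub>R b)"
    using \<open>t > 0\<close> by simp
  moreover have "dist (p a b (x + s *\<^sub>R a + r *\<^sub>R b)) (p a b x) < ?e / 2"
    "dist (p b a (x + r' *\<^sub>R a + s' *\<^sub>R b)) (p b a x) < ?e / 2"
    using d near sr sr' by blast+
  ultimately show False unfolding dist_real_def by (simp add: abs_if split: if_splits)
qed

section \<open>Directional derivatives and brackets in a chart\<close>

definition directional_derivative :: "('a::euclidean_space \<Rightarrow> 'a) \<Rightarrow> ('a \<Rightarrow> real) \<Rightarrow> 'a \<Rightarrow> real" where
  "directional_derivative X f u = frechet_derivative f (at u) (X u)"

definition local_bracket :: "('a::euclidean_space \<Rightarrow> 'a) \<Rightarrow> ('a \<Rightarrow> 'a) \<Rightarrow> 'a \<Rightarrow> 'a" where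
  "local_bracket X Y u = frechet_derivative Y (at u) (X u) - frechet_derivative X (at u) (Y u)"

lemma directional_derivative_eq_sum:
  assumes "f differentiable (at u)"
  shows "directional_derivative X f u = (\<Sum>b\<in>Basis. (X u \<bullet> b) * frechet_derivative f (at u) b)"
  unfolding directional_derivative_def using frechet_derivative_sum_Basis[OF assms, of "X u"] by simp

lemma smooth_on_directional_derivative:
  assumes "open U" "smooth_on U X" "smooth_on U f"
  shows "smooth_on U (directional_derivative X f)"
proof -
  have "smooth_on U (\<lambda>u. \<Sum>b\<in>Basis. (X u \<bullet> b) * frechet_derivative f (at u) b)"
    by (intro smooth_on_sum smooth_on_mult smooth_on_frechet_derivative assms
        smooth_on_bounded_linear[OF _ bounded_linear_inner_left])
  moreover have "smooth_on U (directional_derivative X f) \<longleftrightarrow>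
      smooth_on U (\<lambda>u. \<Sum>b\<in>Basis. (X u \<bullet> b) * frechet_derivative f (at u) b)"
    using assms
    by (intro smooth_on_cong directional_derivative_eq_sum) (auto intro: smooth_on_differentiable)
  ultimately show ?thesis by simp
qed

lemma directional_derivative_cong:
  assumes "open U" "u \<in> U" "f differentiable (at u)" "\<And>x. x \<in> U \<Longrightarrow> f x = g x"
  shows "directional_derivative X f u = directional_derivative X g u"
  unfolding directional_derivative_def
  using frechet_derivative_transform_within_open[OF assms(3,1,2,4)] by simp

lemma directional_derivative_add:
  assumes "f differentiable (at u)" "g differentiable (at u)"
  shows "directional_derivative X (\<lambda>u. f u + g u) u =
    directional_derivative X f u + directional_derivative X g u"
  unfolding directional_derivative_def
  using has_derivative_add[OF assms[unfolded frechet_derivative_works]]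
  by (simp add: frechet_derivative_eqI)

lemma directional_derivative_diff:
  assumes "f differentiable (at u)" "g differentiable (at u)"
  shows "directional_derivative X (\<lambda>u. f u - g u) u =
    directional_derivative X f u - directional_derivative X g u"
  unfolding directional_derivative_def
  using has_derivative_diff[OF assms[unfolded frechet_derivative_works]]
  by (simp add: frechet_derivative_eqI)

lemma directional_derivative_mult:
  assumes "f differentiable (at u)" "g differentiable (at u)"
  shows "directional_derivative X (\<lambda>u. f u * g u) u =
    directional_derivative X f u * g u + f u * directional_derivative X g u"
  unfolding directional_derivative_def
  using has_derivative_mult[OF assms[unfolded frechet_derivative_works]]
  by (simp add: frechet_derivative_eqI)

text \<open>The product rule separates \<open>X(Y f)\<close> into a Hessian term with \<open>Y u\<close> frozen, which is symmetric in
  \<open>X\<close> and \<open>Y\<close>, and the derivative of \<open>f\<close> along \<open>DY(X)\<close>. Both factors of \<open>Df(v)(Y v)\<close> depend on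
  \<open>v\<close>; expanding \<open>Y v\<close> in the standard basis turns the expression into a sum of products of real
  functions.\<close>

lemma directional_derivative_twice:
  assumes "open U" "smooth_on U Y" "smooth_on U f" "u \<in> U"
  shows "directional_derivative X (directional_derivative Y f) u =
    frechet_derivative (\<lambda>v. frechet_derivative f (at v) (Y u)) (at u) (X u)
    + frechet_derivative f (at u) (frechet_derivative Y (at u) (X u))"
proof -
  let ?D = "\<lambda>b v. frechet_derivative f (at v) b"
  have fu: "f differentiable (at v)" if "v \<in> U" for v
    using assms that by (auto intro: smooth_on_differentiable)
  have Db: "(?D b has_derivative frechet_derivative (?D b) (at u)) (at u)" for b
    using assms smooth_on_frechet_derivative smooth_on_differentiable
    unfolding frechet_derivative_works[symmetric] by blast
  have "(Y has_derivative frechet_derivative Y (at u)) (at u)"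
    using assms smooth_on_differentiable unfolding frechet_derivative_works[symmetric] by blast
  then have "((\<lambda>v. \<Sum>b\<in>Basis. (Y v \<bullet> b) * ?D b v) has_derivative
     (\<lambda>h. \<Sum>b\<in>Basis. (Y u \<bullet> b) * frechet_derivative (?D b) (at u) h
        + (frechet_derivative Y (at u) h \<bullet> b) * ?D b u)) (at u)"
    by (intro has_derivative_sum has_derivative_mult Db has_derivative_inner_left)
  moreover have "(directional_derivative Y f) v = (\<Sum>b\<in>Basis. (Y v \<bullet> b) * ?D b v)" if "v \<in> U" for v
    by (rule directional_derivative_eq_sum[OF fu[OF that]])
  ultimately have "(directional_derivative Y f has_derivative
     (\<lambda>h. \<Sum>b\<in>Basis. (Y u \<bullet> b) * frechet_derivative (?D b) (at u) h
        + (frechet_derivative Y (at u) h \<bullet> b) * ?D b u)) (at u)"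
    using has_derivative_transform_within_open[OF _ assms(1,4)] by (metis (no_types, lifting))
  then have "directional_derivative X (directional_derivative Y f) u =
     (\<Sum>b\<in>Basis. (Y u \<bullet> b) * frechet_derivative (?D b) (at u) (X u))
     + (\<Sum>b\<in>Basis. (frechet_derivative Y (at u) (X u) \<bullet> b) * ?D b u)"
    unfolding directional_derivative_def[of X] by (simp add: frechet_derivative_eqI sum.distrib)
  moreover have "(\<Sum>b\<in>Basis. (frechet_derivative Y (at u) (X u) \<bullet> b) * ?D b u) =
      frechet_derivative f (at u) (frechet_derivative Y (at u) (X u))"
    using frechet_derivative_sum_Basis[OF fu[OF assms(4)], of "frechet_derivative Y (at u) (X u)"] by simp
  moreover have "frechet_derivative (?D (Y u)) (at u) (X u) =
    (\<Sum>b\<in>Basis. (Y u \<bullet> b) * frechet_derivative (?D b) (at u) (X u))"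
  proof -
    have "((\<lambda>v. \<Sum>b\<in>Basis. (Y u \<bullet> b) * ?D b v) has_derivative
       (\<lambda>h. \<Sum>b\<in>Basis. (Y u \<bullet> b) * frechet_derivative (?D b) (at u) h)) (at u)"
      by (intro has_derivative_sum has_derivative_mult_right Db)
    moreover have "?D (Y u) v = (\<Sum>b\<in>Basis. (Y u \<bullet> b) * ?D b v)" if "v \<in> U" for v
      using frechet_derivative_sum_Basis[OF fu[OF that], of "Y u"] by simp
    ultimately have "(?D (Y u) has_derivative
       (\<lambda>h. \<Sum>b\<in>Basis. (Y u \<bullet> b) * frechet_derivative (?D b) (at u) h)) (at u)"
      using has_derivative_transform_within_open[OF _ assms(1,4)] by (metis (no_types, lifting))
    then show ?thesis by (simp add: frechet_derivative_eqI)
  qed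
  ultimately show ?thesis by simp
qed

lemma directional_derivative_commutator:
  assumes "open U" "smooth_on U X" "smooth_on U Y" "smooth_on U f" "u \<in> U"
  shows "directional_derivative X (directional_derivative Y f) u
       - directional_derivative Y (directional_derivative X f) u
       = frechet_derivative f (at u) (local_bracket X Y u)"
proof -
  have "f differentiable (at u)" using assms smooth_on_differentiable by blast
  from linear_diff[OF linear_frechet_derivative[OF this]]
  show ?thesis
    using second_derivative_symmetric[OF assms(1,4,5), of "Y u" "X u"]
    by (simp add: directional_derivative_twice[OF assms(1,3,4,5)]
        directional_derivative_twice[OF assms(1,2,4,5)] local_bracket_def)
qed

text \<open>The Jacobi identity of \<open>S, H, V\<close> in operator form. Once it is established that
  \<open>S(S(\<I>)) + V(\<rho>) + \<I>\<rho>\<close> annihilates every \<open>V(f)\<close>, a linear function \<open>f\<close> with \<open>V(f) \<noteq> 0\<close> at the given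
  point shows that it is zero.\<close>

theorem bianchi_identities_of_structure_equations:
  fixes S H V :: "'a::euclidean_space \<Rightarrow> 'a" and \<I> \<rho> :: "'a \<Rightarrow> real"
  assumes U: "open U"
    and smooth_fields: "smooth_on U S" "smooth_on U H" "smooth_on U V"
    and smooth_scalars: "smooth_on U \<I>" "smooth_on U \<rho>"
    and SH: "\<And>u. u \<in> U \<Longrightarrow> local_bracket S H u = \<rho> u *\<^sub>R V u"
    and VS: "\<And>u. u \<in> U \<Longrightarrow> local_bracket V S u = H u"
    and HV: "\<And>u. u \<in> U \<Longrightarrow> local_bracket H V u =
      S u + \<I> u *\<^sub>R H u + directional_derivative S \<I> u *\<^sub>R V u"
    and V: "\<And>u. u \<in> U \<Longrightarrow> V u \<noteq> 0"
    and u: "u \<in> U"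
  shows landsberg_bianchi_identity:
    "directional_derivative S (directional_derivative S \<I>) u
      + directional_derivative V \<rho> u + \<I> u * \<rho> u = 0" (is ?first)
    and landsberg_bianchi_identity_derived:
    "directional_derivative S (\<lambda>u. directional_derivative H \<I> u
        + directional_derivative V (directional_derivative S \<I>) u) u
      + \<I> u * directional_derivative V \<rho> u
      + directional_derivative V (directional_derivative V \<rho>) u = 0" (is ?second)
proof -
  let ?S = "directional_derivative S" and ?H = "directional_derivative H"
    and ?V = "directional_derivative V"
  note smooth = smooth_on_directional_derivative[OF U] smooth_fields smooth_scalars
    smooth_on_add[OF U] smooth_on_mult[OF U]
  have diff: "f differentiable (at x)" if "smooth_on U f" "x \<in> U" for f :: "'a \<Rightarrow> real" and x
    using that by (rule smooth_on_differentiable)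
  have lin: "linear (frechet_derivative f (at x))" if "smooth_on U f" "x \<in> U" for f :: "'a \<Rightarrow> real" and x
    using diff[OF that] by (rule linear_frechet_derivative)
  have cSH: "?S (?H f) x = ?H (?S f) x + \<rho> x * ?V f x" if "smooth_on U f" "x \<in> U" for f x
    using directional_derivative_commutator[OF U smooth_fields(1,2) that] SH[OF that(2)]
      linear_cmul[OF lin[OF that]]
    by (simp add: directional_derivative_def[of V f x])
  have cSV: "?S (?V f) x = ?V (?S f) x - ?H f x" if "smooth_on U f" "x \<in> U" for f x
    using directional_derivative_commutator[OF U smooth_fields(3,1) that] VS[OF that(2)]
    by (simp add: directional_derivative_def[of H f x])
  have cHV: "?H (?V f) x - ?V (?H f) x = ?S f x + \<I> x * ?H f x + ?S \<I> x * ?V f x"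
    if "smooth_on U f" "x \<in> U" for f x
    using directional_derivative_commutator[OF U smooth_fields(2,3) that] HV[OF that(2)]
      linear_cmul[OF lin[OF that]] linear_add[OF lin[OF that]]
    by (simp add: directional_derivative_def[of H f x] directional_derivative_def[of V f x]
        directional_derivative_def[of S f x])
  \<comment> \<open>Apply \<open>S\<close> to \<open>cHV\<close>, and move \<open>S\<close> next to \<open>f\<close> with \<open>cSH\<close> and \<open>cSV\<close>; the second-order
    terms cancel by \<open>cHV\<close> for \<open>S f\<close>.\<close>
  have annihilates: "(?S (?S \<I>) x + ?V \<rho> x + \<I> x * \<rho> x) * ?V f x = 0"
    if f: "smooth_on U f" and x: "x \<in> U" for f x
  proof -
    note s = smooth f
    have "?S (\<lambda>x. ?H (?V f) x - ?V (?H f) x) x =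
        ?S (\<lambda>x. ?S f x + \<I> x * ?H f x + ?S \<I> x * ?V f x) x"
      using cHV f
      by (intro directional_derivative_cong[OF U x] differentiable_diff diff[OF _ x]) (auto intro: s)
    moreover have "?S (\<lambda>x. ?H (?V f) x - ?V (?H f) x) x = ?S (?H (?V f)) x - ?S (?V (?H f)) x"
      by (intro directional_derivative_diff diff[OF _ x] s)
    moreover have "?S (\<lambda>x. ?S f x + \<I> x * ?H f x + ?S \<I> x * ?V f x) x =
      ?S (?S f) x + (?S \<I> x * ?H f x + \<I> x * ?S (?H f) x)
        + (?S (?S \<I>) x * ?V f x + ?S \<I> x * ?S (?V f) x)"
      by (simp add: directional_derivative_add directional_derivative_mult diff[OF _ x] s)
    moreover have "?S (?H (?V f)) x = ?H (?S (?V f)) x + \<rho> x * ?V (?V f) x"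
      by (intro cSH s x)
    moreover have "?H (?S (?V f)) x = ?H (\<lambda>x. ?V (?S f) x - ?H f x) x"
      using cSV f by (intro directional_derivative_cong[OF U x] diff[OF _ x]) (auto intro: s)
    moreover have "?H (\<lambda>x. ?V (?S f) x - ?H f x) x = ?H (?V (?S f)) x - ?H (?H f) x"
      by (intro directional_derivative_diff diff[OF _ x] s)
    moreover have "?S (?V (?H f)) x = ?V (?S (?H f)) x - ?H (?H f) x"
      by (intro cSV s x)
    moreover have "?V (?S (?H f)) x = ?V (\<lambda>x. ?H (?S f) x + \<rho> x * ?V f x) x"
      using cSH f by (intro directional_derivative_cong[OF U x] diff[OF _ x]) (auto intro: s)
    moreover have "?V (\<lambda>x. ?H (?S f) x + \<rho> x * ?V f x) x =
      ?V (?H (?S f)) x + (?V \<rho> x * ?V f x + \<rho> x * ?V (?V f) x)"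
      by (simp add: directional_derivative_add directional_derivative_mult diff[OF _ x] s)
    moreover have "?H (?V (?S f)) x - ?V (?H (?S f)) x = ?S (?S f) x + \<I> x * ?H (?S f) x + ?S \<I> x * ?V (?S f) x"
      by (intro cHV s x)
    moreover note cSH[OF f x] cSV[OF f x]
    ultimately show ?thesis by algebra
  qed
  \<comment> \<open>The test function is \<open>y \<mapsto> y \<bullet> V x\<close>, whose derivative along \<open>V\<close> at \<open>x\<close> is \<open>V x \<bullet> V x\<close>.\<close>
  have first: "?S (?S \<I>) x + ?V \<rho> x + \<I> x * \<rho> x = 0" if x: "x \<in> U" for x
  proof -
    have bl: "bounded_linear (\<lambda>y. y \<bullet> V x)" by (rule bounded_linear_inner_left)
    have "?V (\<lambda>y. y \<bullet> V x) x = V x \<bullet> V x"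
      unfolding directional_derivative_def
      using frechet_derivative_eqI[OF bounded_linear_imp_has_derivative[OF bl], of x] by simp
    then show ?thesis
      using annihilates[OF smooth_on_bounded_linear_self[OF U bl] x] V[OF x] by simp
  qed
  then show ?first using u .
  have "?S (\<lambda>u. ?H \<I> u + ?V (?S \<I>) u) u = ?S (?H \<I>) u + ?S (?V (?S \<I>)) u"
    by (intro directional_derivative_add diff[OF _ u] smooth)
  moreover have "?S (?H \<I>) u = ?H (?S \<I>) u + \<rho> u * ?V \<I> u"
    by (intro cSH smooth u)
  moreover have "?S (?V (?S \<I>)) u = ?V (?S (?S \<I>)) u - ?H (?S \<I>) u"
    by (intro cSV smooth u)
  moreover have "?V (?S (?S \<I>)) u = ?V (\<lambda>x. (- 1) * (?V \<rho> x + \<I> x * \<rho> x)) u"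
  proof (rule directional_derivative_cong[OF U u])
    show "?S (?S \<I>) differentiable (at u)" by (intro diff[OF _ u] smooth)
    show "?S (?S \<I>) x = (- 1) * (?V \<rho> x + \<I> x * \<rho> x)" if "x \<in> U" for x
      using first[OF that] by simp
  qed
  moreover have "?V (\<lambda>x. (- 1) * (?V \<rho> x + \<I> x * \<rho> x)) u =
    - (?V (?V \<rho>) u + (?V \<I> u * \<rho> u + \<I> u * ?V \<rho> u))"
  proof -
    have "?V (\<lambda>x. (- 1) * (?V \<rho> x + \<I> x * \<rho> x)) u =
      ?V (\<lambda>x. - 1) u * (?V \<rho> u + \<I> u * \<rho> u) + (- 1) * ?V (\<lambda>x. ?V \<rho> x + \<I> x * \<rho> x) u"
      by (intro directional_derivative_mult diff[OF _ u] smooth smooth_on_const)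
    moreover have "?V (\<lambda>x. - 1) u = 0" by (simp add: directional_derivative_def)
    moreover have "?V (\<lambda>x. ?V \<rho> x + \<I> x * \<rho> x) u = ?V (?V \<rho>) u + ?V (\<lambda>x. \<I> x * \<rho> x) u"
      by (intro directional_derivative_add diff[OF _ u] smooth)
    moreover have "?V (\<lambda>x. \<I> x * \<rho> x) u = ?V \<I> u * \<rho> u + \<I> u * ?V \<rho> u"
      by (intro directional_derivative_mult diff[OF _ u] smooth)
    ultimately show ?thesis by simp
  qed
  ultimately show ?second by (simp add: algebra_simps)
qed

section \<open>Vector fields and functions on an atlas\<close>

text \<open>What the calculus of vector fields needs from an atlas. No topology on the points is involved, so
  the property can be checked for the induced charts without topologizing the slit tangent bundle.
  Taking \<open>d = c\<close> shows that the chart images are open.\<close>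

definition differentiable_atlas :: "('p, 'e::euclidean_space) chart set \<Rightarrow> bool" where
  "differentiable_atlas B \<longleftrightarrow>
     (\<forall>c\<in>B. inj_on (snd c) (fst c)) \<and>
     (\<forall>c\<in>B. \<forall>d\<in>B. open (snd c ` (fst c \<inter> fst d)) \<and>
        (\<forall>x\<in>snd c ` (fst c \<inter> fst d). transition c d differentiable (at x)))"

lemma chart_inv_chart:
  assumes "differentiable_atlas B" "c \<in> B" "q \<in> fst c"
  shows "chart_inv c (snd c q) = q"
  using assms unfolding differentiable_atlas_def chart_inv_def by simp

lemma chart_inv_mem: "u \<in> chart_image c \<Longrightarrow> chart_inv c u \<in> fst c"
  unfolding chart_image_def chart_inv_def by (rule inv_into_into)

lemma chart_chart_inv: "u \<in> chart_image c \<Longrightarrow> snd c (chart_inv c u) = u"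
  unfolding chart_image_def chart_inv_def by (rule f_inv_into_f)

lemma chart_mem_chart_image: "q \<in> fst c \<Longrightarrow> snd c q \<in> chart_image c"
  unfolding chart_image_def by simp

lemma open_chart_image: "differentiable_atlas B \<Longrightarrow> c \<in> B \<Longrightarrow> open (chart_image c)"
  unfolding differentiable_atlas_def chart_image_def by (metis Int_absorb)

lemma transition_chart:
  assumes "differentiable_atlas B" "c \<in> B" "q \<in> fst c"
  shows "transition c d (snd c q) = snd d q"
  using chart_inv_chart[OF assms] by (simp add: transition_def)

lemma transition_has_derivative:
  assumes "differentiable_atlas B" "c \<in> B" "d \<in> B" "q \<in> fst c" "q \<in> fst d"
  shows "(transition c d has_derivative frechet_derivative (transition c d) (at (snd c q))) (at (snd c q))"
  using assms unfolding differentiable_atlas_def frechet_derivative_works[symmetric] by blast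

lemma frechet_derivative_change_of_chart:
  assumes B: "differentiable_atlas B" and c: "c \<in> B" "q \<in> fst c" and d: "d \<in> B" "q \<in> fst d"
    and f: "(f \<circ> chart_inv d) differentiable (at (snd d q))"
  shows "frechet_derivative (f \<circ> chart_inv c) (at (snd c q)) v =
    frechet_derivative (f \<circ> chart_inv d) (at (snd d q))
      (frechet_derivative (transition c d) (at (snd c q)) v)"
proof -
  have "((f \<circ> chart_inv d) \<circ> transition c d has_derivative
      frechet_derivative (f \<circ> chart_inv d) (at (snd d q)) \<circ> frechet_derivative (transition c d) (at (snd c q)))
      (at (snd c q))"
    using transition_has_derivative[OF B c(1) d(1) c(2) d(2)] f transition_chart[OF B c, of d]
    by (intro diff_chain_at) (simp_all add: frechet_derivative_works[symmetric])
  moreover have "open (snd c ` (fst c \<inter> fst d))" "snd c q \<in> snd c ` (fst c \<inter> fst d)"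
    using B c d unfolding differentiable_atlas_def by blast+
  moreover have "((f \<circ> chart_inv d) \<circ> transition c d) x = (f \<circ> chart_inv c) x"
    if "x \<in> snd c ` (fst c \<inter> fst d)" for x
    using that chart_inv_chart[OF B d(1)] chart_inv_chart[OF B c(1)] transition_chart[OF B c(1), of _ d]
    by auto
  ultimately have "((f \<circ> chart_inv c) has_derivative
      frechet_derivative (f \<circ> chart_inv d) (at (snd d q)) \<circ> frechet_derivative (transition c d) (at (snd c q)))
      (at (snd c q))"
    by (rule has_derivative_transform_within_open)
  then show ?thesis by (simp add: frechet_derivative_eqI)
qed

lemma smooth_function_differentiable:
  "smooth_function B f \<Longrightarrow> c \<in> B \<Longrightarrow> q \<in> fst c \<Longrightarrow> (f \<circ> chart_inv c) differentiable (at (snd c q))"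
  unfolding smooth_function_def by (meson smooth_on_differentiable chart_mem_chart_image)

text \<open>The chart in which \<open>derivative_along\<close> evaluates a field varies with the point in an uncontrolled
  way. The transformation rules of tangent vectors and of derivatives cancel, so that any chart may
  be used.\<close>

lemma field_apply_in_chart:
  assumes B: "differentiable_atlas B" and f: "smooth_function B f"
    and X: "smooth_vector_field B X" and c: "c \<in> B" "q \<in> fst c"
  shows "field_apply B X f q =
    directional_derivative (local_field c X) (f \<circ> chart_inv c) (snd c q)"
proof -
  define d where "d = (SOME c. c \<in> B \<and> q \<in> fst c)"
  have d: "d \<in> B" "q \<in> fst d"
    using someI[of "\<lambda>c. c \<in> B \<and> q \<in> fst c" c] c by (simp_all add: d_def)
  have "X q \<in> tangent_space B q"
    using X c by (auto simp: smooth_vector_field_def carrier_of_def)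
  then have "X q d = frechet_derivative (transition c d) (at (snd c q)) (X q c)"
    using c d unfolding tangent_space_def by blast
  then show ?thesis
    using frechet_derivative_change_of_chart[OF B c d smooth_function_differentiable[OF f d]]
    by (simp add: field_apply_def derivative_along_def d_def[symmetric] directional_derivative_def
        local_field_def chart_inv_chart[OF B c])
qed

lemma field_apply_comp_chart_inv:
  assumes "differentiable_atlas B" "smooth_function B f" "smooth_vector_field B X" "c \<in> B"
    and "u \<in> chart_image c"
  shows "(field_apply B X f \<circ> chart_inv c) u =
    directional_derivative (local_field c X) (f \<circ> chart_inv c) u"
  using field_apply_in_chart[OF assms(1-4) chart_inv_mem[OF assms(5)]] chart_chart_inv[OF assms(5)]
  by simp

lemma smooth_function_field_apply:
  assumes "differentiable_atlas B" "smooth_function B f" "smooth_vector_field B X"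
  shows "smooth_function B (field_apply B X f)"
  unfolding smooth_function_def
proof
  fix c assume c: "c \<in> B"
  have "smooth_on (chart_image c) (directional_derivative (local_field c X) (f \<circ> chart_inv c))"
    using assms c open_chart_image[OF assms(1) c]
    by (intro smooth_on_directional_derivative) (auto simp: smooth_function_def smooth_vector_field_def)
  then show "smooth_on (chart_image c) (field_apply B X f \<circ> chart_inv c)"
    using field_apply_comp_chart_inv[OF assms c] smooth_on_cong open_chart_image[OF assms(1) c]
    by metis
qed

lemma smooth_function_add:
  assumes "differentiable_atlas B" "smooth_function B f" "smooth_function B g"
  shows "smooth_function B (\<lambda>q. f q + g q)"
  using assms smooth_on_add open_chart_image unfolding smooth_function_def comp_def by blast

lemma smooth_function_mult:
  assumes "differentiable_atlas B" "smooth_function B f" "smooth_function B g"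
  shows "smooth_function B (\<lambda>q. f q * g q)"
  using assms smooth_on_mult open_chart_image unfolding smooth_function_def comp_def by blast

lemma lie_bracket_in_chart:
  assumes "differentiable_atlas B" "c \<in> B" "u \<in> chart_image c"
  shows "lie_bracket B X Y (chart_inv c u) c = local_bracket (local_field c X) (local_field c Y) u"
  using assms chart_inv_mem[OF assms(3)] chart_chart_inv[OF assms(3)]
  by (simp add: lie_bracket_def local_bracket_def local_field_def)

text \<open>All terms are expressed in one chart around \<open>q\<close>. An inner derivative such as \<open>S(\<I>)\<close> has its
  local form on the whole chart image, and so may be differentiated again there.\<close>

theorem bianchi_identities_on_atlas:
  fixes S H V :: "('p, 'e::euclidean_space) vector_field"
  assumes B: "differentiable_atlas B"
    and fields: "smooth_vector_field B S" "smooth_vector_field B H" "smooth_vector_field B V"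
    and scalars: "smooth_function B \<I>" "smooth_function B \<rho>"
    and SH: "\<And>q. q \<in> carrier_of B \<Longrightarrow> lie_bracket B S H q = (\<lambda>c. \<rho> q *\<^sub>R V q c)"
    and VS: "\<And>q. q \<in> carrier_of B \<Longrightarrow> lie_bracket B V S q = H q"
    and HV: "\<And>q. q \<in> carrier_of B \<Longrightarrow> lie_bracket B H V q =
      (\<lambda>c. S q c + \<I> q *\<^sub>R H q c + field_apply B S \<I> q *\<^sub>R V q c)"
    and V: "\<And>c q. c \<in> B \<Longrightarrow> q \<in> fst c \<Longrightarrow> V q c \<noteq> 0"
    and q: "q \<in> carrier_of B"
  shows "field_apply B S (field_apply B S \<I>) q + field_apply B V \<rho> q + \<I> q * \<rho> q = 0"
    and "field_apply B S (\<lambda>q. field_apply B H \<I> q + field_apply B V (field_apply B S \<I>) q) q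
      + \<I> q * field_apply B V \<rho> q + field_apply B V (field_apply B V \<rho>) q = 0"
proof -
  obtain c where c: "c \<in> B" "q \<in> fst c" using q unfolding carrier_of_def by blast
  let ?U = "chart_image c" and ?loc = "\<lambda>f. f \<circ> chart_inv c"
  let ?D = "\<lambda>X. directional_derivative (local_field c X)"
  have U: "open ?U" by (rule open_chart_image[OF B c(1)])
  have carrier: "chart_inv c u \<in> carrier_of B" if "u \<in> ?U" for u
    using chart_inv_mem[OF that] c(1) unfolding carrier_of_def by blast
  note smooth = fields scalars smooth_function_field_apply[OF B] smooth_function_add[OF B]
  have sm: "smooth_on ?U (?loc f)" if "smooth_function B f" for f
    using that c(1) unfolding smooth_function_def by blast
  have smX: "smooth_on ?U (local_field c X)" if "smooth_vector_field B X" for X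
    using that c(1) unfolding smooth_vector_field_def by blast
  have apply_twice: "field_apply B Y f q = ?D Y g (snd c q)"
    if "smooth_vector_field B Y" "smooth_function B f" "\<And>u. u \<in> ?U \<Longrightarrow> ?loc f u = g u" for Y f g
    using field_apply_in_chart[OF B that(2,1) c]
      directional_derivative_cong[OF U chart_mem_chart_image[OF c(2)]
        smooth_function_differentiable[OF that(2) c] that(3), where X = "local_field c Y"]
    by simp
  have local_SH: "local_bracket (local_field c S) (local_field c H) u = ?loc \<rho> u *\<^sub>R local_field c V u"
    and local_VS: "local_bracket (local_field c V) (local_field c S) u = local_field c H u"
    and local_HV: "local_bracket (local_field c H) (local_field c V) u =
      local_field c S u + ?loc \<I> u *\<^sub>R local_field c H u + ?D S (?loc \<I>) u *\<^sub>R local_field c V u"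
    if "u \<in> ?U" for u
    using SH[OF carrier[OF that]] VS[OF carrier[OF that]] HV[OF carrier[OF that]]
      field_apply_comp_chart_inv[OF B scalars(1) fields(1) c(1) that]
    by (simp_all add: lie_bracket_in_chart[OF B c(1) that, symmetric] local_field_def)
  have local_V: "local_field c V u \<noteq> 0" if "u \<in> ?U" for u
    using V[OF c(1) chart_inv_mem[OF that]] by (simp add: local_field_def)
  note identities = bianchi_identities_of_structure_equations[OF U smX[OF fields(1)] smX[OF fields(2)]
    smX[OF fields(3)] sm[OF scalars(1)] sm[OF scalars(2)] local_SH local_VS local_HV local_V
    chart_mem_chart_image[OF c(2)]]
  have loc: "?loc (field_apply B Y f) u = ?D Y (?loc f) u"
    if "smooth_function B f" "smooth_vector_field B Y" "u \<in> ?U" for Y f u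
    by (rule field_apply_comp_chart_inv[OF B that(1,2) c(1) that(3)])
  have locq: "?loc f (snd c q) = f q" for f :: "'p \<Rightarrow> real"
    by (simp add: chart_inv_chart[OF B c])
  have S_\<J>: "field_apply B S (field_apply B S \<I>) q = ?D S (?D S (?loc \<I>)) (snd c q)"
    by (intro apply_twice smooth loc)
  have V_\<rho>: "field_apply B V \<rho> q = ?D V (?loc \<rho>) (snd c q)"
    by (intro apply_twice smooth refl)
  have VV_\<rho>: "field_apply B V (field_apply B V \<rho>) q = ?D V (?D V (?loc \<rho>)) (snd c q)"
    by (intro apply_twice smooth loc)
  have "?loc (\<lambda>q. field_apply B H \<I> q + field_apply B V (field_apply B S \<I>) q) u =
      ?D H (?loc \<I>) u + ?D V (?D S (?loc \<I>)) u" if u: "u \<in> ?U" for u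
  proof -
    have "?loc (field_apply B V (field_apply B S \<I>)) u = ?D V (?loc (field_apply B S \<I>)) u"
      by (intro loc smooth u)
    also have "\<dots> = ?D V (?D S (?loc \<I>)) u"
      by (intro directional_derivative_cong[OF U u] smooth_on_differentiable[OF sm u] smooth loc)
    finally show ?thesis using loc[OF scalars(1) fields(2) u] by simp
  qed
  then have S_\<F>: "field_apply B S (\<lambda>q. field_apply B H \<I> q + field_apply B V (field_apply B S \<I>) q) q =
      ?D S (\<lambda>u. ?D H (?loc \<I>) u + ?D V (?D S (?loc \<I>)) u) (snd c q)"
    by (intro apply_twice smooth)
  show "field_apply B S (field_apply B S \<I>) q + field_apply B V \<rho> q + \<I> q * \<rho> q = 0"
    using identities(1)[unfolded locq] unfolding S_\<J> V_\<rho> .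
  show "field_apply B S (\<lambda>q. field_apply B H \<I> q + field_apply B V (field_apply B S \<I>) q) q
      + \<I> q * field_apply B V \<rho> q + field_apply B V (field_apply B V \<rho>) q = 0"
    using identities(2)[unfolded locq] unfolding S_\<F> V_\<rho> VV_\<rho> .
qed

section \<open>The atlas of the slit tangent bundle\<close>

lemma differentiable_atlas_of_smooth_manifold:
  assumes "smooth_manifold X A"
  shows "differentiable_atlas A"
  unfolding differentiable_atlas_def
proof (intro conjI ballI)
  have chart: "openin X (fst c)" "open (chart_image c)"
    "homeomorphic_map (subtopology X (fst c)) (top_of_set (chart_image c)) (snd c)" if "c \<in> A" for c
    using assms that unfolding smooth_manifold_def by blast+
  have space: "topspace (subtopology X (fst c)) = fst c" if "c \<in> A" for c
    using openin_subset[OF chart(1)[OF that]] by auto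
  show "inj_on (snd c) (fst c)" if "c \<in> A" for c
    using chart(3)[OF that] space[OF that] unfolding homeomorphic_eq_everything_map by simp
  show "open (snd c ` (fst c \<inter> fst d))" if "c \<in> A" "d \<in> A" for c d
  proof -
    have "openin (subtopology X (fst c)) (fst c \<inter> fst d)"
      using chart(1)[OF that(2)] openin_subtopology_Int2 by blast
    then have "openin (top_of_set (chart_image c)) (snd c ` (fst c \<inter> fst d))"
      using chart(3)[OF that(1)] homeomorphic_imp_open_map open_map_def by blast
    then show ?thesis using chart(2)[OF that(1)] openin_open_trans by blast
  qed
  show "transition c d differentiable at x"
    if "c \<in> A" "d \<in> A" "x \<in> snd c ` (fst c \<inter> fst d)" for c d x
    using assms that unfolding smooth_manifold_def by (blast intro: smooth_on_differentiable)
qed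

lemma transition_self_frechet_derivative:
  assumes A: "differentiable_atlas A" and c: "c \<in> A" "p \<in> fst c"
  shows "frechet_derivative (transition c c) (at (snd c p)) = id"
proof (rule frechet_derivative_eqI)
  show "(transition c c has_derivative id) (at (snd c p))"
  proof (rule has_derivative_transform_within_open[of id])
    show "open (chart_image c)" by (rule open_chart_image[OF A c(1)])
    show "snd c p \<in> chart_image c" by (rule chart_mem_chart_image[OF c(2)])
    show "id x = transition c c x" if "x \<in> chart_image c" for x
      using chart_chart_inv[OF that] by (simp add: transition_def)
  qed simp
qed

lemma transition_chain_frechet_derivative:
  assumes A: "differentiable_atlas A" and c: "c \<in> A" "p \<in> fst c"
    and d: "d \<in> A" "p \<in> fst d" and e: "e \<in> A" "p \<in> fst e"
  shows "frechet_derivative (transition c e) (at (snd c p)) v =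
    frechet_derivative (transition d e) (at (snd d p)) (frechet_derivative (transition c d) (at (snd c p)) v)"
proof -
  have "(transition c e has_derivative
      frechet_derivative (transition d e) (at (snd d p)) \<circ> frechet_derivative (transition c d) (at (snd c p)))
      (at (snd c p))"
  proof (rule has_derivative_transform_within_open[of "transition d e \<circ> transition c d"])
    show "(transition d e \<circ> transition c d has_derivative
      frechet_derivative (transition d e) (at (snd d p)) \<circ> frechet_derivative (transition c d) (at (snd c p)))
      (at (snd c p))"
      using transition_has_derivative[OF A c(1) d(1) c(2) d(2)]
        transition_has_derivative[OF A d(1) e(1) d(2) e(2)] transition_chart[OF A c, of d]
      by (intro diff_chain_at) simp_all
    show "open (snd c ` (fst c \<inter> fst d))" "snd c p \<in> snd c ` (fst c \<inter> fst d)"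
      using A c d unfolding differentiable_atlas_def by blast+
    show "(transition d e \<circ> transition c d) x = transition c e x"
      if "x \<in> snd c ` (fst c \<inter> fst d)" for x
      using that transition_chart[OF A c(1), of _ d] transition_chart[OF A c(1), of _ e]
        transition_chart[OF A d(1), of _ e] by auto
  qed
  then show ?thesis by (simp add: frechet_derivative_eqI)
qed

lemma tangent_space_eq_of_component:
  assumes c: "c \<in> A" "p \<in> fst c" and w: "w \<in> tangent_space A p" "w' \<in> tangent_space A p" and eq: "w c = w' c"
  shows "w = w'"
proof
  fix d
  show "w d = w' d"
  proof (cases "d \<in> A \<and> p \<in> fst d")
    case True
    then have "w d = frechet_derivative (transition c d) (at (snd c p)) (w c)"
      "w' d = frechet_derivative (transition c d) (at (snd c p)) (w' c)"
      using w c unfolding tangent_space_def by blast+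
    with eq show ?thesis by simp
  next
    case False
    then have "w d = 0" "w' d = 0" using w unfolding tangent_space_def by blast+
    then show ?thesis by simp
  qed
qed

lemma zero_in_tangent_space:
  assumes A: "differentiable_atlas A"
  shows "(\<lambda>_. 0) \<in> tangent_space A p"
proof -
  have "0 = frechet_derivative (transition c d) (at (snd c p)) 0"
    if "c \<in> A" "d \<in> A" "p \<in> fst c" "p \<in> fst d" for c d
    by (rule linear_0[OF has_derivative_linear[OF transition_has_derivative[OF A that]], symmetric])
  then show ?thesis unfolding tangent_space_def by simp
qed

text \<open>The vector with component \<open>y\<close> in the chart \<open>c\<close> gets its other components from the Jacobians of
  the transitions from \<open>c\<close>; the chain rule makes this family compatible.\<close>

lemma tangent_space_component_surj:
  assumes A: "differentiable_atlas A" and c: "c \<in> A" "p \<in> fst c"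
  obtains w where "w \<in> tangent_space A p" "w c = y"
proof
  let ?w = "\<lambda>d. if d \<in> A \<and> p \<in> fst d then frechet_derivative (transition c d) (at (snd c p)) y else 0"
  show "?w \<in> tangent_space A p"
    unfolding tangent_space_def mem_Collect_eq
  proof (intro conjI ballI impI allI)
    show "?w d = 0" if "d \<notin> A \<or> p \<notin> fst d" for d using that by auto
    show "?w e = frechet_derivative (transition d e) (at (snd d p)) (?w d)"
      if "d \<in> A" "e \<in> A" "p \<in> fst d \<and> p \<in> fst e" for d e
    proof -
      have "frechet_derivative (transition c e) (at (snd c p)) y = frechet_derivative (transition d e)
          (at (snd d p)) (frechet_derivative (transition c d) (at (snd c p)) y)"
        using that by (intro transition_chain_frechet_derivative[OF A c]) auto
      then show ?thesis using that by simp
    qed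
  qed
  show "?w c = y"
    using transition_self_frechet_derivative[OF A c] c by simp
qed

lemma fst_induced_chart: "fst (induced_chart A c) = {q \<in> slit_bundle A. fst q \<in> fst c}"
  and snd_induced_chart: "snd (induced_chart A c) q = (snd c (fst q), snd q c)"
  by (simp_all add: induced_chart_def case_prod_beta)

text \<open>A nonzero tangent vector is nonzero in every chart, because its components in one chart determine
  it.\<close>

lemma snd_component_nonzero:
  assumes A: "differentiable_atlas A" and c: "c \<in> A" and q: "q \<in> fst (induced_chart A c)"
  shows "snd q c \<noteq> 0"
proof
  assume "snd q c = 0"
  moreover have "fst q \<in> fst c" "snd q \<in> tangent_space A (fst q)" "snd q \<noteq> (\<lambda>_. 0)"
    using q by (auto simp: fst_induced_chart slit_bundle_def)
  ultimately show False
    using tangent_space_eq_of_component[OF c, of "fst q" "snd q" "\<lambda>_. 0"] zero_in_tangent_space[OF A]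
    by blast
qed

lemma carrier_of_slit_atlas: "carrier_of (slit_atlas A) = slit_bundle A"
  unfolding carrier_of_def slit_atlas_def
  by (auto simp: fst_induced_chart) (auto simp: slit_bundle_def carrier_of_def)

lemma induced_chart_inj:
  assumes A: "differentiable_atlas A" and c: "c \<in> A"
  shows "inj_on (snd (induced_chart A c)) (fst (induced_chart A c))"
proof (rule inj_onI)
  fix q r
  assume q: "q \<in> fst (induced_chart A c)" and r: "r \<in> fst (induced_chart A c)"
    and eq: "snd (induced_chart A c) q = snd (induced_chart A c) r"
  have mem: "fst q \<in> fst c" "fst r \<in> fst c"
      "snd q \<in> tangent_space A (fst q)" "snd r \<in> tangent_space A (fst r)"
    using q r by (auto simp: fst_induced_chart slit_bundle_def)
  have "fst q = fst r"
    using eq mem A c unfolding differentiable_atlas_def by (auto simp: snd_induced_chart dest: inj_onD)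
  moreover have "snd q = snd r"
    using tangent_space_eq_of_component[OF c mem(1,3)] mem eq \<open>fst q = fst r\<close>
    by (simp add: snd_induced_chart)
  ultimately show "q = r" by (rule prod_eqI)
qed

lemma induced_chart_overlap:
  assumes A: "differentiable_atlas A" and c: "c \<in> A"
  shows "snd (induced_chart A c) ` (fst (induced_chart A c) \<inter> fst (induced_chart A d)) =
    (snd c ` (fst c \<inter> fst d)) \<times> (UNIV - {0})" (is "?L = ?R")
proof
  show "?L \<subseteq> ?R"
    using snd_component_nonzero[OF A c] by (auto simp: snd_induced_chart fst_induced_chart)
  show "?R \<subseteq> ?L"
  proof
    fix z assume "z \<in> ?R"
    then obtain p y where p: "p \<in> fst c" "p \<in> fst d" and z: "z = (snd c p, y)" "y \<noteq> 0" by auto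
    obtain w where w: "w \<in> tangent_space A p" "w c = y"
      using tangent_space_component_surj[OF A c p(1)] .
    have "(p, w) \<in> slit_bundle A"
      using w z p c by (auto simp: slit_bundle_def carrier_of_def)
    then have "(p, w) \<in> fst (induced_chart A c) \<inter> fst (induced_chart A d)"
      using p by (simp add: fst_induced_chart)
    moreover have "z = snd (induced_chart A c) (p, w)"
      by (simp add: snd_induced_chart z w)
    ultimately show "z \<in> ?L" by blast
  qed
qed

lemma induced_transition:
  assumes A: "differentiable_atlas A" and c: "c \<in> A" and d: "d \<in> A"
    and z: "z \<in> (snd c ` (fst c \<inter> fst d)) \<times> (UNIV - {0})"
  shows "transition (induced_chart A c) (induced_chart A d) z =
    (transition c d (fst z), frechet_derivative (transition c d) (at (fst z)) (snd z))"
proof -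
  obtain q where q: "q \<in> fst (induced_chart A c)" "q \<in> fst (induced_chart A d)"
    and z: "z = snd (induced_chart A c) q"
    using z induced_chart_overlap[OF A c, of d] by blast
  have "transition (induced_chart A c) (induced_chart A d) z = snd (induced_chart A d) q"
    using inv_into_f_f[OF induced_chart_inj[OF A c] q(1)] by (simp add: z transition_def chart_inv_def)
  moreover have "fst q \<in> fst c" "fst q \<in> fst d" "snd q \<in> tangent_space A (fst q)"
    using q by (auto simp: fst_induced_chart slit_bundle_def)
  moreover from this have "snd q d = frechet_derivative (transition c d) (at (snd c (fst q))) (snd q c)"
    using c d unfolding tangent_space_def by blast
  ultimately show ?thesis
    using transition_chart[OF A c, of "fst q" d] by (simp add: z snd_induced_chart)
qed

text \<open>The derivative of \<open>(x, y) \<mapsto> (\<tau>(x), D\<tau>(x) y)\<close> is block triangular with the diagonal blocks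
  \<open>D\<tau>(x)\<close>; \<open>L\<close> is the off-diagonal block \<open>a \<mapsto> D\<^sup>2\<tau>(x)(a, y)\<close>.\<close>

lemma induced_transition_has_derivative:
  assumes M: "smooth_manifold X A" and c: "c \<in> A" and d: "d \<in> A"
    and x: "x \<in> snd c ` (fst c \<inter> fst d)" and y: "y \<noteq> 0"
  shows "\<exists>L. (transition (induced_chart A c) (induced_chart A d) has_derivative
     (\<lambda>h. (frechet_derivative (transition c d) (at x) (fst h),
           L (fst h) + frechet_derivative (transition c d) (at x) (snd h)))) (at (x, y))
     \<and> linear L"
proof -
  let ?D = "\<lambda>b x. frechet_derivative (transition c d) (at x) b" and ?W = "snd c ` (fst c \<inter> fst d)"
  define L where "L h = (\<Sum>b\<in>Basis. (y \<bullet> b) *\<^sub>R frechet_derivative (?D b) (at x) h)" for h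
  note A = differentiable_atlas_of_smooth_manifold[OF M]
  have W: "open ?W" using A c d unfolding differentiable_atlas_def by blast
  have smooth: "smooth_on ?W (transition c d)"
    using M c d unfolding smooth_manifold_def by blast
  note diff = smooth_on_differentiable[OF smooth] smooth_on_differentiable[OF smooth_on_frechet_derivative[OF smooth]]
  have x': "fst (x, y) = x" by simp
  have \<tau>: "((\<lambda>z. transition c d (fst z)) has_derivative (\<lambda>h. ?D (fst h) x)) (at (x, y))"
    using has_derivative_compose[OF has_derivative_fst[OF has_derivative_ident],
        of "transition c d" "frechet_derivative (transition c d) (at x)" "(x,y)" UNIV] diff(1)[OF x]
    by (simp add: frechet_derivative_works[symmetric])
  have Db: "((\<lambda>z. ?D b (fst z)) has_derivative (\<lambda>h. frechet_derivative (?D b) (at x) (fst h))) (at (x, y))" for b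
    using has_derivative_compose[OF has_derivative_fst[OF has_derivative_ident],
        of "?D b" "frechet_derivative (?D b) (at x)" "(x,y)" UNIV] diff(2)[OF x]
    by (simp add: frechet_derivative_works[symmetric])
  have "((\<lambda>z. \<Sum>b\<in>Basis. (snd z \<bullet> b) *\<^sub>R ?D b (fst z)) has_derivative
     (\<lambda>h. \<Sum>b\<in>Basis. (snd (x, y) \<bullet> b) *\<^sub>R frechet_derivative (?D b) (at x) (fst h)
        + (snd h \<bullet> b) *\<^sub>R ?D b (fst (x, y)))) (at (x, y))"
    by (intro has_derivative_sum has_derivative_scaleR Db has_derivative_inner_left
        has_derivative_snd has_derivative_ident)
  moreover have "(\<Sum>b\<in>Basis. (snd (x, y) \<bullet> b) *\<^sub>R frechet_derivative (?D b) (at x) (fst h)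
        + (snd h \<bullet> b) *\<^sub>R ?D b (fst (x, y))) = L (fst h) + ?D (snd h) x" for h
    using frechet_derivative_sum_Basis[OF diff(1)[OF x], of "snd h"]
    by (simp add: L_def sum.distrib)
  ultimately have "((\<lambda>z. \<Sum>b\<in>Basis. (snd z \<bullet> b) *\<^sub>R ?D b (fst z)) has_derivative
     (\<lambda>h. L (fst h) + ?D (snd h) x)) (at (x, y))"
    by simp
  from has_derivative_Pair[OF \<tau> this]
  have "((\<lambda>z. (transition c d (fst z), \<Sum>b\<in>Basis. (snd z \<bullet> b) *\<^sub>R ?D b (fst z))) has_derivative
     (\<lambda>h. (?D (fst h) x, L (fst h) + ?D (snd h) x))) (at (x, y))" .
  then have "(transition (induced_chart A c) (induced_chart A d) has_derivative
     (\<lambda>h. (?D (fst h) x, L (fst h) + ?D (snd h) x))) (at (x, y))"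
  proof (rule has_derivative_transform_within_open)
    show "open (?W \<times> (UNIV - {0 :: real^2}))" by (intro open_Times W open_delete open_UNIV)
    show "(x, y) \<in> ?W \<times> (UNIV - {0})" using x y by simp
    show "(transition c d (fst z), \<Sum>b\<in>Basis. (snd z \<bullet> b) *\<^sub>R ?D b (fst z)) =
        transition (induced_chart A c) (induced_chart A d) z" if "z \<in> ?W \<times> (UNIV - {0})" for z
      using induced_transition[OF A c d that] that
        frechet_derivative_sum_Basis[OF diff(1), of "fst z" "snd z"] by auto
  qed
  moreover have "linear L"
    unfolding L_def
    by (intro linear_compose_sum ballI linear_compose_scale_right linear_frechet_derivative diff(2) x)
  ultimately show ?thesis by blast
qed

lemma differentiable_atlas_slit_atlas:
  assumes M: "smooth_manifold X A"
  shows "differentiable_atlas (slit_atlas A)"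
  unfolding differentiable_atlas_def
proof (intro conjI ballI)
  note A = differentiable_atlas_of_smooth_manifold[OF M]
  show "inj_on (snd C) (fst C)" if "C \<in> slit_atlas A" for C
    using that induced_chart_inj[OF A] by (auto simp: slit_atlas_def)
  fix C D assume "C \<in> slit_atlas A" "D \<in> slit_atlas A"
  then obtain c d where c: "c \<in> A" "C = induced_chart A c" and d: "d \<in> A" "D = induced_chart A d"
    by (auto simp: slit_atlas_def)
  have overlap: "snd C ` (fst C \<inter> fst D) = (snd c ` (fst c \<inter> fst d)) \<times> (UNIV - {0})"
    using induced_chart_overlap[OF A c(1), of d] c d by simp
  show "open (snd C ` (fst C \<inter> fst D))"
    unfolding overlap using A c d
    by (intro open_Times open_delete open_UNIV) (simp add: differentiable_atlas_def)
  show "transition C D differentiable at z" if "z \<in> snd C ` (fst C \<inter> fst D)" for z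
  proof -
    have "fst z \<in> snd c ` (fst c \<inter> fst d)" "snd z \<noteq> 0"
      using that unfolding overlap by auto
    from induced_transition_has_derivative[OF M c(1) d(1) this] show ?thesis
      by (auto simp: c d differentiable_def)
  qed
qed

text \<open>The almost-tangent structure \<open>(a, b) \<mapsto> (0, a)\<close> commutes with block triangular maps whose diagonal
  blocks are equal. Hence \<open>JH\<close> transforms as a vector field.\<close>

lemma smooth_vector_field_tangent_structure_field:
  assumes M: "smooth_manifold X A" and H: "smooth_vector_field (slit_atlas A) H"
  shows "smooth_vector_field (slit_atlas A) (tangent_structure_field H)"
  unfolding smooth_vector_field_def
proof (intro conjI ballI)
  let ?B = "slit_atlas A"
  note A = differentiable_atlas_of_smooth_manifold[OF M] and B = differentiable_atlas_slit_atlas[OF M]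
  fix q assume "q \<in> carrier_of ?B"
  then have Hq: "H q \<in> tangent_space ?B q" using H unfolding smooth_vector_field_def by blast
  show "tangent_structure_field H q \<in> tangent_space ?B q"
    unfolding tangent_space_def mem_Collect_eq
  proof (intro conjI allI impI ballI)
    fix C assume "C \<notin> ?B \<or> q \<notin> fst C"
    then have "H q C = 0" using Hq unfolding tangent_space_def by blast
    then show "tangent_structure_field H q C = 0"
      by (simp add: tangent_structure_field_def tangent_structure_def zero_prod_def)
  next
    fix C D assume CD: "C \<in> ?B" "D \<in> ?B" and q: "q \<in> fst C \<and> q \<in> fst D"
    then obtain c d where c: "c \<in> A" "C = induced_chart A c" and d: "d \<in> A" "D = induced_chart A d"
      by (auto simp: slit_atlas_def)
    let ?\<tau> = "frechet_derivative (transition c d) (at (snd c (fst q)))"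
    have mem: "snd c (fst q) \<in> snd c ` (fst c \<inter> fst d)"
      using q c d by (auto simp: fst_induced_chart)
    have y: "snd q c \<noteq> 0" using snd_component_nonzero[OF A c(1)] q c by simp
    obtain L where "linear L" and
      "(transition C D has_derivative (\<lambda>h. (?\<tau> (fst h), L (fst h) + ?\<tau> (snd h)))) (at (snd C q))"
      using induced_transition_has_derivative[OF M c(1) d(1) mem y] by (auto simp: c d snd_induced_chart)
    then have T: "frechet_derivative (transition C D) (at (snd C q)) = (\<lambda>h. (?\<tau> (fst h), L (fst h) + ?\<tau> (snd h)))"
      by (simp add: frechet_derivative_eqI)
    have "H q D = frechet_derivative (transition C D) (at (snd C q)) (H q C)"
      using Hq CD q unfolding tangent_space_def by blast
    moreover have "?\<tau> 0 = 0"
      using A c d mem unfolding differentiable_atlas_def by (blast intro: linear_0 linear_frechet_derivative)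
    ultimately show "tangent_structure_field H q D =
        frechet_derivative (transition C D) (at (snd C q)) (tangent_structure_field H q C)"
      using linear_0[OF \<open>linear L\<close>]
      by (simp add: T tangent_structure_field_def tangent_structure_def)
  qed
next
  fix C assume C: "C \<in> slit_atlas A"
  have "bounded_linear (\<lambda>z::(real^2)\<times>(real^2). (0::real^2, fst z))"
    by (intro bounded_linear_Pair bounded_linear_zero bounded_linear_fst)
  moreover have "local_field C (tangent_structure_field H) = (\<lambda>u. (0, fst (local_field C H u)))"
    by (simp add: fun_eq_iff local_field_def tangent_structure_field_def tangent_structure_def)
  ultimately show "smooth_on (chart_image C) (local_field C (tangent_structure_field H))"
    using smooth_on_bounded_linear[of "chart_image C" "\<lambda>z. (0, fst z)" "local_field C H"]
      open_chart_image[OF differentiable_atlas_slit_atlas[OF M] C] H C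
    by (simp add: smooth_vector_field_def)
qed

section \<open>The Berwald frame\<close>

text \<open>In induced coordinates, the base component of a spray is the function \<open>(x, y) \<mapsto> y\<close>.\<close>

lemma spray_base_component_derivative:
  assumes M: "smooth_manifold X A" and S: "geodesic_spray A F S"
    and c: "c \<in> slit_atlas A" and u: "u \<in> chart_image c"
  shows "fst (frechet_derivative (local_field c S) (at u) h) = snd h"
proof -
  have U: "open (chart_image c)"
    by (rule open_chart_image[OF differentiable_atlas_slit_atlas[OF M] c])
  have "smooth_on (chart_image c) (local_field c S)"
    using S c unfolding geodesic_spray_def smooth_vector_field_def by blast
  then have Ds: "(local_field c S has_derivative frechet_derivative (local_field c S) (at u)) (at u)"
    using smooth_on_differentiable u by (simp add: frechet_derivative_works[symmetric])
  have "((\<lambda>u. fst (local_field c S u)) has_derivative snd) (at u)"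
  proof (rule has_derivative_transform_within_open[OF _ U u])
    show "(snd has_derivative snd) (at u)"
      by (rule bounded_linear_imp_has_derivative[OF bounded_linear_snd])
    show "snd v = fst (local_field c S v)" if "v \<in> chart_image c" for v
      using S c that unfolding geodesic_spray_def by simp
  qed
  then show ?thesis
    using has_derivative_unique[OF has_derivative_fst[OF Ds]] by metis
qed

text \<open>The derivatives of \<open>Y\<close> and the vertical part of \<open>Y\<close> drop out of \<open>Y + [JY,S] - J[Y,S]\<close>, which
  leaves a linear function of the base component \<open>a\<close> of \<open>Y\<close>. In coordinates, with
  \<open>S = y\<^sup>i \<partial>/\<partial>x\<^sup>i - 2G\<^sup>i \<partial>/\<partial>y\<^sup>i\<close>, the result is the horizontal lift
  \<open>a\<^sup>j (\<partial>/\<partial>x\<^sup>j - (\<partial>G\<^sup>i/\<partial>y\<^sup>j) \<partial>/\<partial>y\<^sup>i)\<close>.\<close>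

lemma horizontal_projector_in_chart:
  assumes M: "smooth_manifold X A" and S: "geodesic_spray A F S"
    and Y: "smooth_vector_field (slit_atlas A) Y"
    and c: "c \<in> slit_atlas A" and q: "q \<in> fst c"
  shows "horizontal_projector A S Y q c = (1/2) *\<^sub>R
    ((fst (Y q c), 0) + frechet_derivative (local_field c S) (at (snd c q)) (0, fst (Y q c)))"
proof -
  let ?B = "slit_atlas A" and ?y = "local_field c Y" and ?s = "local_field c S" and ?u = "snd c q"
  note B = differentiable_atlas_slit_atlas[OF M]
  have u: "?u \<in> chart_image c" by (rule chart_mem_chart_image[OF q])
  have Dy: "(?y has_derivative frechet_derivative ?y (at ?u)) (at ?u)"
    using Y c u smooth_on_differentiable
    unfolding frechet_derivative_works[symmetric] smooth_vector_field_def by blast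
  have loc: "S q c = ?s ?u" "Y q c = ?y ?u"
    using chart_inv_chart[OF B c q] by (simp_all add: local_field_def)
  have D: "((\<lambda>u. (0, fst (?y u))) has_derivative (\<lambda>h. (0, fst (frechet_derivative ?y (at ?u) h)))) (at ?u)"
    by (intro has_derivative_Pair has_derivative_const has_derivative_fst Dy)
  have J_local: "local_field c (tangent_structure_field Y) = (\<lambda>u. (0, fst (?y u)))"
    by (simp add: fun_eq_iff local_field_def tangent_structure_field_def tangent_structure_def)
  have DJ: "frechet_derivative (local_field c (tangent_structure_field Y)) (at ?u) =
      (\<lambda>h. (0, fst (frechet_derivative ?y (at ?u) h)))"
    unfolding J_local by (rule frechet_derivative_eqI[OF D])
  have JY: "tangent_structure_field Y q c = (0, fst (?y ?u))"
    by (simp add: loc tangent_structure_field_def tangent_structure_def)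
  note fst_Ds = spray_base_component_derivative[OF M S c u]
  have JY_S: "lie_bracket ?B (tangent_structure_field Y) S q c =
      frechet_derivative ?s (at ?u) (0, fst (?y ?u)) - (0, fst (frechet_derivative ?y (at ?u) (?s ?u)))"
    using c q JY by (simp add: lie_bracket_def DJ loc)
  have J_YS: "tangent_structure (lie_bracket ?B Y S q) c =
      (0, snd (?y ?u) - fst (frechet_derivative ?y (at ?u) (?s ?u)))"
    using c q by (simp add: lie_bracket_def loc tangent_structure_def fst_Ds)
  have "?y ?u + (frechet_derivative ?s (at ?u) (0, fst (?y ?u))
        - (0, fst (frechet_derivative ?y (at ?u) (?s ?u)))
        - (0, snd (?y ?u) - fst (frechet_derivative ?y (at ?u) (?s ?u)))) =
      (fst (?y ?u), 0) + frechet_derivative ?s (at ?u) (0, fst (?y ?u))"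
    by (simp add: prod_eq_iff)
  then show ?thesis
    unfolding horizontal_projector_def JY_S J_YS unfolding loc by simp
qed

text \<open>A horizontal vector is the horizontal lift of its base component, so it vanishes together with that
  component, hence together with its image under \<open>J\<close>.\<close>

lemma horizontal_zero_of_base_component_zero:
  assumes M: "smooth_manifold X A" and S: "geodesic_spray A F S" and H: "horizontal A S H"
    and c: "c \<in> slit_atlas A" and q: "q \<in> fst c" and zero: "fst (H q c) = 0"
  shows "H q c = 0"
proof -
  obtain Y where Y: "smooth_vector_field (slit_atlas A) Y"
    and HY: "\<forall>q\<in>slit_bundle A. H q = horizontal_projector A S Y q"
    using H unfolding horizontal_def by blast
  have "q \<in> slit_bundle A"
    using c q by (auto simp: slit_atlas_def fst_induced_chart)
  then have Hqc: "H q c = (1/2) *\<^sub>R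
    ((fst (Y q c), 0) + frechet_derivative (local_field c S) (at (snd c q)) (0, fst (Y q c)))"
    using HY horizontal_projector_in_chart[OF M S Y c q] by simp
  have sm: "smooth_on (chart_image c) (local_field c S)"
    using S c unfolding geodesic_spray_def smooth_vector_field_def by blast
  have u: "snd c q \<in> chart_image c" by (rule chart_mem_chart_image[OF q])
  have "fst (H q c) = fst (Y q c)"
    unfolding Hqc using spray_base_component_derivative[OF M S c u] by (simp add: scaleR_add_left[symmetric])
  with zero show ?thesis
    unfolding Hqc using linear_0[OF linear_frechet_derivative[OF smooth_on_differentiable[OF sm u]]]
    by (simp add: zero_prod_def[symmetric])
qed

text \<open>The bracket of two fields vanishes at a common zero. At a zero of \<open>V = JH\<close> the field \<open>H\<close> vanishes too,
  so the equation \<open>[H,V] = S + \<I>H + \<J>V\<close> would give \<open>S = 0\<close> there, although the base component of \<open>S\<close> is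
  the nonzero vector \<open>y\<close>.\<close>

lemma berwald_vertical_field_nonzero:
  assumes M: "smooth_manifold X A" and S: "geodesic_spray A F S" and H: "berwald_frame A F S K H \<I>"
    and c: "c \<in> slit_atlas A" and q: "q \<in> fst c"
  shows "tangent_structure_field H q c \<noteq> 0"
proof
  let ?V = "tangent_structure_field H" and ?B = "slit_atlas A"
  note B = differentiable_atlas_slit_atlas[OF M]
  assume V0: "?V q c = 0"
  then have "fst (H q c) = 0"
    by (simp add: tangent_structure_field_def tangent_structure_def zero_prod_def)
  moreover have "horizontal A S H" and H_smooth: "smooth_vector_field ?B H"
    using H by (simp_all add: berwald_frame_def Let_def)
  ultimately have H0: "H q c = 0"
    using horizontal_zero_of_base_component_zero[OF M S _ c q] by blast
  have q': "q \<in> slit_bundle A"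
    using c q by (auto simp: slit_atlas_def fst_induced_chart)
  then have "lie_bracket ?B H ?V q =
      (\<lambda>c. S q c + \<I> q *\<^sub>R H q c + landsberg_scalar A S \<I> q *\<^sub>R ?V q c)"
    using H by (simp add: berwald_frame_def Let_def)
  then have "lie_bracket ?B H ?V q c = S q c" using H0 V0 by simp
  moreover have "lie_bracket ?B H ?V q c = 0"
  proof -
    have "smooth_vector_field ?B ?V"
      by (rule smooth_vector_field_tangent_structure_field[OF M H_smooth])
    then have "linear (frechet_derivative (local_field c H) (at (snd c q)))"
      "linear (frechet_derivative (local_field c ?V) (at (snd c q)))"
      using H_smooth c chart_mem_chart_image[OF q] smooth_on_differentiable linear_frechet_derivative
      unfolding smooth_vector_field_def by blast+
    then show ?thesis
      using c q H0 V0 by (simp add: lie_bracket_def linear_0)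
  qed
  ultimately have "fst (S q c) = 0" by simp
  moreover have "fst (S q c) = snd (snd c q)"
    using S c chart_mem_chart_image[OF q] chart_inv_chart[OF B c q]
    unfolding geodesic_spray_def by (metis local_field_def)
  moreover have "snd (snd c q) \<noteq> 0"
  proof -
    obtain d where d: "d \<in> A" "c = induced_chart A d"
      using c by (auto simp: slit_atlas_def)
    show ?thesis
      using snd_component_nonzero[OF differentiable_atlas_of_smooth_manifold[OF M] d(1), of q] q
      by (simp add: d(2) snd_induced_chart)
  qed
  ultimately show False by simp
qed

theorem theorem3p7:
  fixes X :: "'m topology" and A :: "'m surface_chart set"
    and F K \<I> \<J> \<rho> \<F> :: "'m tm \<Rightarrow> real" and S H V :: "'m tm_field"
  assumes "smooth_manifold X A"
    and "finsler_function A F"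
    and "geodesic_spray A F S"
    and "flag_curvature A F S K"
    and "nonflat A K"
    and "berwald_frame A F S K H \<I>"
    and "V = tangent_structure_field H"
    and "\<J> = landsberg_scalar A S \<I>"
    and "\<rho> = ricci_scalar F K"
    and "\<F> = (\<lambda>q. field_apply (slit_atlas A) H \<I> q + field_apply (slit_atlas A) V \<J> q)"
  shows "\<forall>q\<in>slit_bundle A.
    field_apply (slit_atlas A) S \<J> q + field_apply (slit_atlas A) V \<rho> q + \<I> q * \<rho> q = 0 \<and>
    field_apply (slit_atlas A) S \<F> q + \<I> q * field_apply (slit_atlas A) V \<rho> q
      + field_apply (slit_atlas A) V (field_apply (slit_atlas A) V \<rho>) q = 0"
proof
  fix q assume q: "q \<in> slit_bundle A"
  let ?B = "slit_atlas A"
  note B = differentiable_atlas_slit_atlas[OF assms(1)]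
  have \<J>: "\<J> = field_apply ?B S \<I>"
    using assms(8) by (simp add: landsberg_scalar_def)
  have frame: "smooth_vector_field ?B H" "smooth_function ?B \<I>"
    and brackets: "lie_bracket ?B S H r = (\<lambda>c. \<rho> r *\<^sub>R V r c)" "lie_bracket ?B V S r = H r"
    "lie_bracket ?B H V r = (\<lambda>c. S r c + \<I> r *\<^sub>R H r c + field_apply ?B S \<I> r *\<^sub>R V r c)"
    if "r \<in> carrier_of ?B" for r
    using assms(6,7,9) that unfolding carrier_of_slit_atlas
    by (simp_all add: berwald_frame_def Let_def landsberg_scalar_def)
  have carrier: "q \<in> carrier_of ?B" using q by (simp add: carrier_of_slit_atlas)
  have S: "smooth_vector_field ?B S" using assms(3) by (simp add: geodesic_spray_def)
  have V: "smooth_vector_field ?B V"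
    unfolding assms(7) by (rule smooth_vector_field_tangent_structure_field[OF assms(1) frame(1)[OF carrier]])
  have "smooth_function ?B (\<lambda>q. K q * (F q * F q))"
    using assms(2,4) by (intro smooth_function_mult B) (simp_all add: finsler_function_def flag_curvature_def)
  then have \<rho>: "smooth_function ?B \<rho>"
    unfolding assms(9) ricci_scalar_def by (simp add: power2_eq_square)
  have V_nonzero: "V r c \<noteq> 0" if "c \<in> ?B" "r \<in> fst c" for c r
    unfolding assms(7) using berwald_vertical_field_nonzero[OF assms(1,3,6) that] .
  note identities = bianchi_identities_on_atlas[OF B S frame(1)[OF carrier] V frame(2)[OF carrier] \<rho>
    brackets V_nonzero carrier]
  show "field_apply ?B S \<J> q + field_apply ?B V \<rho> q + \<I> q * \<rho> q = 0 \<and>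
    field_apply ?B S \<F> q + \<I> q * field_apply ?B V \<rho> q + field_apply ?B V (field_apply ?B V \<rho>) q = 0"
    unfolding assms(10) \<J> using identities by blast
qed

end
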